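(* Let $\{\mathbf w^k\}=\{(\mathbf x^k,y^k,\lambda^k)\}$ be generated by ADMM-LQP with $\beta>0$, $0<\mu<1$ and $(\alpha,\tau)\in\mathcal K$, and suppose that for some $\gamma>\frac{p-1}{1-\mu}$ one has $r_i\ge\gamma\beta\|A_i^{\sf T}A_i\|$ for $i=1,\dots,p$. Then: (i) $\lim_{k\to\infty}\sum_{i=1}^p\|A_i(x_i^k-x_i^{k+1})\|^2=0$ and $\lim_{k\to\infty}\|A\mathbf x^{k+1}+By^{k+1}-b\|^2=0$; (ii) any accumulation point of $\{\mathbf w^k\}$ belongs to $\mathcal W^*$, i.e. is a solution of the variational inequality $\mathrm{VI}(\Theta,\mathcal J,\mathcal W)$; (iii) there exists a point $\mathbf w^\infty\in\mathcal W^*$ such that $\lim_{k\to\infty}\mathbf w^k=\mathbf w^\infty$.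
   Context: Problem. Let $p\ge1$ be an integer, $A_i\in\mathbb R^{n\times m_i}$ ($i=1,\dots,p$) and $B\in\mathbb R^{n\times d}$ matrices of full column rank, $b\in\mathbb R^n$, $f_i:\mathbb R_+^{m_i}\to\mathbb R$ and $g:\mathbb R^d\to\mathbb R$ closed proper convex functions, $\mathcal Y\subset\mathbb R^d$ a closed convex set. The problem is: minimize $\sum_{i=1}^pf_i(x_i)+g(y)$ subject to $\sum_{i=1}^pA_ix_i+By=b$, $x_i\in\mathbb R_+^{m_i}$, $y\in\mathcal Y$; its solution set is assumed nonempty. Write $A=(A_1,\dots,A_p)$, $\mathbf x=(x_1;\dots;x_p)$, $\mathcal X=\mathbb R_+^{m_1}\times\cdots\times\mathbb R_+^{m_p}$, $\mathcal W=\mathcal X\times\mathcal Y\times\mathbb R^n$, $\mathbf w=(\mathbf x,y,\lambda)$, $\Theta(\mathbf w)=\sum_{i=1}^pf_i(x_i)+g(y)$ and $\mathcal J(\mathbf w)=(-A^{\sf T}\lambda;\,-B^{\sf T}\lambda;\,A\mathbf x+By-b)$. $\mathcal W^*$ is the set of solutions of $\mathrm{VI}(\Theta,\mathcal J,\mathcal W)$: those $\mathbf w^*\in\mathcal W$ with $\Theta(\mathbf w)-\Theta(\mathbf w^* )+\langle\mathbf w-\mathbf w^*,\mathcal J(\mathbf w^* )\rangle\ge0$ for all $\mathbf w\in\mathcal W$ (equivalently with $\mathcal J(\mathbf w)$ in place of $\mathcal J(\mathbf w^* )$). $\mathcal W^*$ is nonempty. Augmented Lagrangian: $\mathcal L_\beta(\mathbf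 x,y,\lambda)=\sum_if_i(x_i)+g(y)-\langle\lambda,A\mathbf x+By-b\rangle+\frac\beta2\|A\mathbf x+By-b\|^2$. LQP regularizer: for fixed $0<\mu<1$ and $z\in\mathbb R_{++}^m$, $d(v,z)=\sum_{j=1}^m\big[\frac12(v_j-z_j)^2+\mu(z_j^2\log\frac{z_j}{v_j}+v_jz_j-z_j^2)\big]$ if $v\in\mathbb R_{++}^m$, and $+\infty$ otherwise. $\mathcal K=\{(\alpha,\tau): -1<\alpha<1,\ \alpha+\tau>0,\ 1+\alpha+\tau-\alpha\tau-\alpha^2-\tau^2>0\}$. ADMM-LQP. Given $\beta>0$, $r_i>0$, $(\alpha,\tau)\in\mathcal K$ and a starting point $(x_1^0,\dots,x_p^0,y^0,\lambda^0)$ with $x_i^0\in\mathbb R_{++}^{m_i}$ (so that $d$ is defined), for $k=0,1,2,\dots$: $x_i^{k+1}=\arg\min_{x_i\in\mathbb R_+^{m_i}}\mathcal L_\beta(x_1^k,\dots,x_{i-1}^k,x_i,x_{i+1}^k,\dots,x_p^k,y^k,\lambda^k)+r_id(x_i,x_i^k)$ for $i=1,\dots,p$; $\lambda^{k+\frac12}=\lambda^k-\alpha\beta(A\mathbf x^{k+1}+By^k-b)$; $y^{k+1}=\arg\min_{y\in\mathcal Y}\mathcal L_\beta(\mathbf x^{k+1},y,\lambda^{k+\frac12})$; $\lambda^{k+1}=\lambda^{k+\frac12}-\tau\beta(A\mathbf x^{k+1}+By^{k+1}-b)$. For matrices, $\|\cdot\|$ is the norm induced by the Euclidean norm. *)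

theory Defs
  imports "HOL-Analysis.Analysis"
begin

text \<open>
  The block dimensions \<open>m\<^sub>i\<close> may differ from block to block.  Blocks are indexed by a finite type
  \<open>'p\<close> (so \<open>p = CARD('p)\<close>), and all blocks share one coordinate type \<open>'m\<close>.  Block \<open>i\<close> uses only the
  coordinates in \<open>I i :: 'm set\<close>: the space \<open>R^(m\<^sub>i)\<close> is the coordinate subspace of
  \<open>real^'m\<close> of vectors vanishing outside \<open>I i\<close>, with \<open>m\<^sub>i = card (I i)\<close>, and \<open>A\<^sub>i\<close> is a matrix whose
  columns outside \<open>I i\<close> are zero.  Zero padding changes neither norms, nor inner products, nor
  ranks, nor the operator norm of \<open>A\<^sub>i\<^sup>T A\<^sub>i\<close>.  Since \<open>'m\<close> and \<open>I\<close> are arbitrary, every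
  choice of dimensions \<open>m\<^sub>i\<close> is covered.
\<close>

definition nonneg_orthant :: "'m::finite set \<Rightarrow> (real^'m) set" where
  "nonneg_orthant J = {v. (\<forall>j\<in>J. 0 \<le> v $ j) \<and> (\<forall>j. j \<notin> J \<longrightarrow> v $ j = 0)}"

definition pos_orthant :: "'m::finite set \<Rightarrow> (real^'m) set" where
  "pos_orthant J = {v. (\<forall>j\<in>J. 0 < v $ j) \<and> (\<forall>j. j \<notin> J \<longrightarrow> v $ j = 0)}"

definition columns_supported :: "'m::finite set \<Rightarrow> (real^'m^'n::finite) \<Rightarrow> bool" where
  "columns_supported J M \<longleftrightarrow> (\<forall>j. j \<notin> J \<longrightarrow> column j M = 0)"

text \<open>
  A real-valued function on \<open>S\<close>, extended by \<open>+\<infinity>\<close> outside \<open>S\<close>, is proper iff \<open>S \<noteq> {}\<close>, and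
  closed iff its epigraph is closed.
\<close>

definition closed_proper_convex_on :: "'a::euclidean_space set \<Rightarrow> ('a \<Rightarrow> real) \<Rightarrow> bool" where
  "closed_proper_convex_on S f \<longleftrightarrow> S \<noteq> {} \<and> convex_on S f \<and> closed (epigraph S f)"

type_synonym ('p, 'm, 'd, 'n) primal_dual = "((real^'m)^'p) \<times> (real^'d) \<times> (real^'n)"

definition residual ::
  "('p::finite \<Rightarrow> real^'m::finite^'n::finite) \<Rightarrow> (real^'d::finite^'n) \<Rightarrow> real^'n
    \<Rightarrow> (real^'m)^'p \<Rightarrow> real^'d \<Rightarrow> real^'n" where
  "residual A B b x y = (\<Sum>i\<in>UNIV. A i *v x $ i) + B *v y - b"

definition objective ::
  "('p::finite \<Rightarrow> real^'m::finite \<Rightarrow> real) \<Rightarrow> (real^'d::finite \<Rightarrow> real)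
    \<Rightarrow> (real^'m)^'p \<Rightarrow> real^'d \<Rightarrow> real" where
  "objective f g x y = (\<Sum>i\<in>UNIV. f i (x $ i)) + g y"

definition X_set :: "('p::finite \<Rightarrow> 'm::finite set) \<Rightarrow> ((real^'m)^'p) set" where
  "X_set I = {x. \<forall>i. x $ i \<in> nonneg_orthant (I i)}"

definition problem_solutions ::
  "('p::finite \<Rightarrow> 'm::finite set) \<Rightarrow> ('p \<Rightarrow> real^'m^'n::finite) \<Rightarrow> (real^'d::finite^'n) \<Rightarrow> real^'n
    \<Rightarrow> ('p \<Rightarrow> real^'m \<Rightarrow> real) \<Rightarrow> (real^'d \<Rightarrow> real) \<Rightarrow> (real^'d) set
    \<Rightarrow> (((real^'m)^'p) \<times> (real^'d)) set" where
  "problem_solutions I A B b f g Y =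
    {s. is_arg_min (\<lambda>(x, y). objective f g x y)
          (\<lambda>(x, y). x \<in> X_set I \<and> y \<in> Y \<and> residual A B b x y = 0) s}"

definition VI_solutions :: "('a::real_inner \<Rightarrow> real) \<Rightarrow> ('a \<Rightarrow> 'a) \<Rightarrow> 'a set \<Rightarrow> 'a set" where
  "VI_solutions \<Theta> J W = {ws \<in> W. \<forall>w\<in>W. \<Theta> w - \<Theta> ws + (w - ws) \<bullet> J ws \<ge> 0}"

definition \<Theta>_fun ::
  "('p::finite \<Rightarrow> real^'m::finite \<Rightarrow> real) \<Rightarrow> (real^'d::finite \<Rightarrow> real)
    \<Rightarrow> ('p, 'm, 'd, 'n::finite) primal_dual \<Rightarrow> real" where
  "\<Theta>_fun f g = (\<lambda>(x, y, l). objective f g x y)"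

definition J_map ::
  "('p::finite \<Rightarrow> real^'m::finite^'n::finite) \<Rightarrow> (real^'d::finite^'n) \<Rightarrow> real^'n
    \<Rightarrow> ('p, 'm, 'd, 'n) primal_dual \<Rightarrow> ('p, 'm, 'd, 'n) primal_dual" where
  "J_map A B b = (\<lambda>(x, y, l).
     (\<chi> i. - (transpose (A i) *v l), - (transpose B *v l), residual A B b x y))"

definition W_set ::
  "('p::finite \<Rightarrow> 'm::finite set) \<Rightarrow> (real^'d::finite) set
    \<Rightarrow> ('p, 'm, 'd, 'n::finite) primal_dual set" where
  "W_set I Y = X_set I \<times> Y \<times> UNIV"

definition W_star ::
  "('p::finite \<Rightarrow> 'm::finite set) \<Rightarrow> ('p \<Rightarrow> real^'m^'n::finite) \<Rightarrow> (real^'d::finite^'n) \<Rightarrow> real^'n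
    \<Rightarrow> ('p \<Rightarrow> real^'m \<Rightarrow> real) \<Rightarrow> (real^'d \<Rightarrow> real) \<Rightarrow> (real^'d) set
    \<Rightarrow> ('p, 'm, 'd, 'n) primal_dual set" where
  "W_star I A B b f g Y = VI_solutions (\<Theta>_fun f g) (J_map A B b) (W_set I Y)"

definition aug_lagrangian ::
  "('p::finite \<Rightarrow> real^'m::finite^'n::finite) \<Rightarrow> (real^'d::finite^'n) \<Rightarrow> real^'n
    \<Rightarrow> ('p \<Rightarrow> real^'m \<Rightarrow> real) \<Rightarrow> (real^'d \<Rightarrow> real) \<Rightarrow> real
    \<Rightarrow> (real^'m)^'p \<Rightarrow> real^'d \<Rightarrow> real^'n \<Rightarrow> real" where
  "aug_lagrangian A B b f g \<beta> x y l =
     objective f g x y - l \<bullet> residual A B b x y + \<beta> / 2 * (norm (residual A B b x y))\<^sup>2"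

definition lqp :: "real \<Rightarrow> 'm::finite set \<Rightarrow> real^'m \<Rightarrow> real^'m \<Rightarrow> ereal" where
  "lqp \<mu> J v z =
    (if v \<in> pos_orthant J
     then ereal (\<Sum>j\<in>J. (v $ j - z $ j)\<^sup>2 / 2
            + \<mu> * ((z $ j)\<^sup>2 * ln (z $ j / v $ j) + v $ j * z $ j - (z $ j)\<^sup>2))
     else \<infinity>)"

definition replace_block :: "(real^'m::finite)^'p::finite \<Rightarrow> 'p \<Rightarrow> real^'m \<Rightarrow> (real^'m)^'p" where
  "replace_block x i u = (\<chi> j. if j = i then u else x $ j)"

definition step_region :: "(real \<times> real) set" where
  "step_region = {(\<alpha>, \<tau>). -1 < \<alpha> \<and> \<alpha> < 1 \<and> \<alpha> + \<tau> > 0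
      \<and> 1 + \<alpha> + \<tau> - \<alpha> * \<tau> - \<alpha>\<^sup>2 - \<tau>\<^sup>2 > 0}"

definition admm_lqp ::
  "('p::finite \<Rightarrow> 'm::finite set) \<Rightarrow> ('p \<Rightarrow> real^'m^'n::finite) \<Rightarrow> (real^'d::finite^'n) \<Rightarrow> real^'n
    \<Rightarrow> ('p \<Rightarrow> real^'m \<Rightarrow> real) \<Rightarrow> (real^'d \<Rightarrow> real) \<Rightarrow> (real^'d) set
    \<Rightarrow> real \<Rightarrow> real \<Rightarrow> ('p \<Rightarrow> real) \<Rightarrow> real \<Rightarrow> real
    \<Rightarrow> (nat \<Rightarrow> (real^'m)^'p) \<Rightarrow> (nat \<Rightarrow> real^'d) \<Rightarrow> (nat \<Rightarrow> real^'n) \<Rightarrow> bool" where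
  "admm_lqp I A B b f g Y \<beta> \<mu> r \<alpha> \<tau> x y l \<longleftrightarrow>
    (\<forall>i. x 0 $ i \<in> pos_orthant (I i)) \<and>
    (\<forall>k. (\<forall>i. is_arg_min
                (\<lambda>u. ereal (aug_lagrangian A B b f g \<beta> (replace_block (x k) i u) (y k) (l k))
                       + ereal (r i) * lqp \<mu> (I i) u (x k $ i))
                (\<lambda>u. u \<in> nonneg_orthant (I i))
                (x (Suc k) $ i)) \<and>
         (let lhalf = l k - (\<alpha> * \<beta>) *\<^sub>R residual A B b (x (Suc k)) (y k) in
            is_arg_min (\<lambda>v. aug_lagrangian A B b f g \<beta> (x (Suc k)) v lhalf)
              (\<lambda>v. v \<in> Y) (y (Suc k)) \<and>
            l (Suc k) = lhalf - (\<tau> * \<beta>) *\<^sub>R residual A B b (x (Suc k)) (y (Suc k))))"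

definition accumulation_point :: "(nat \<Rightarrow> 'a::topological_space) \<Rightarrow> 'a \<Rightarrow> bool" where
  "accumulation_point w a \<longleftrightarrow> (\<exists>s. strict_mono s \<and> (w \<circ> s) \<longlonglongrightarrow> a)"

end

theory Submission
  imports Defs
begin

text \<open>
  The optimality conditions of the subproblems at \<open>w\<^sup>k\<^sup>+\<^sup>1\<close>, tested with a solution \<open>w\<^sup>*\<close> of the
  variational inequality, are added up.  With \<open>q\<^sup>k = B (y\<^sup>k - y\<^sup>*)\<close> and
  \<open>\<eta>\<^sup>k = \<lambda>\<^sup>k - \<lambda>\<^sup>* - \<alpha> \<beta> q\<^sup>k\<close> the two multiplier updates collapse to the single step
  \<open>\<eta>\<^sup>k\<^sup>+\<^sup>1 = \<eta>\<^sup>k - (\<alpha> + \<tau>) \<beta> R\<^sup>k\<^sup>+\<^sup>1\<close>, where \<open>R\<close> is the primal residual, and the sum telescopes.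
  The parallel \<open>x\<close>-updates contribute the quadratic form
  \<open>\<beta> (\<Sum>\<^sub>i \<parallel>A\<^sub>i u\<^sub>i\<parallel>\<^sup>2 - \<parallel>\<Sum>\<^sub>i A\<^sub>i u\<^sub>i\<parallel>\<^sup>2)\<close>, which the bound on \<open>\<gamma>\<close> makes harmless.
  The only bad term left is \<open>\<langle>R\<^sup>k\<^sup>+\<^sup>1, B (y\<^sup>k\<^sup>+\<^sup>1 - y\<^sup>k)\<rangle>\<close>; monotonicity of two consecutive
  \<open>y\<close>-steps trades it for \<open>\<langle>R\<^sup>k, B (y\<^sup>k\<^sup>+\<^sup>1 - y\<^sup>k)\<rangle>\<close>, and the last inequality defining \<open>\<K>\<close> is exactly
  what lets \<open>\<parallel>R\<^sup>k\<parallel>\<^sup>2\<close> enter the Lyapunov function with a net decrease.  Hence residuals and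
  \<open>x\<close>-differences vanish, limit points solve the variational inequality because the
  epigraphs are closed, and the Lyapunov function centred at a limit point tends to zero.
\<close>

section \<open>First-order conditions, the LQP regularizer, and norm and limit estimates\<close>

text \<open>Only the smooth part \<phi> is differentiated. Convexity bounds the increment of
  \<open>f\<close> along the segment by \<open>t * (f u - f z)\<close>, so dividing the minimality
  inequality by \<open>t\<close> and letting \<open>t\<close> decrease to 0 gives a variational
  inequality without subgradients of \<open>f\<close>.\<close>

lemma first_order_optimality:
  fixes f :: "'a::real_vector \<Rightarrow> real"
  assumes f: "convex_on S f" and z: "z \<in> S" and u: "u \<in> S"
    and min: "\<And>t. 0 < t \<Longrightarrow> t < 1 \<Longrightarrow> f z + \<phi> 0 \<le> f ((1 - t) *\<^sub>R z + t *\<^sub>R u) + \<phi> t"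
    and der: "(\<phi> has_real_derivative D) (at 0)"
  shows "0 \<le> f u - f z + D"
proof -
  have lim: "((\<lambda>t. (\<phi> t - \<phi> 0) / t) \<longlongrightarrow> D) (at_right 0)"
    using has_field_derivative_at_within[OF der, of "{0<..}"]
    by (simp add: has_field_derivative_iff)
  have "f z - f u \<le> (\<phi> t - \<phi> 0) / t" if t: "0 < t" "t < 1" for t
  proof -
    have "f ((1 - t) *\<^sub>R z + t *\<^sub>R u) \<le> (1 - t) * f z + t * f u"
      using t f z u by (intro convex_onD) auto
    with min[OF t] have "t * (f z - f u) \<le> \<phi> t - \<phi> 0"
      by (simp add: algebra_simps)
    with t show ?thesis by (simp add: field_simps)
  qed
  then have "\<forall>\<^sub>F t in at_right 0. f z - f u \<le> (\<phi> t - \<phi> 0) / t"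
    by (auto simp: eventually_at_right_field intro!: exI[of _ 1])
  from tendsto_lowerbound[OF lim this] show ?thesis by simp
qed

lemma quadratic_line_derivative:
  fixes c l w :: "'a::real_inner"
  shows "((\<lambda>t. \<beta> / 2 * (norm (c + t *\<^sub>R w))\<^sup>2 - l \<bullet> (c + t *\<^sub>R w))
    has_real_derivative (w \<bullet> (\<beta> *\<^sub>R c - l))) (at 0)"
proof -
  have eq: "(\<lambda>t. \<beta> / 2 * (norm (c + t *\<^sub>R w))\<^sup>2 - l \<bullet> (c + t *\<^sub>R w))
    = (\<lambda>t. \<beta> / 2 * (c \<bullet> c + 2 * t * (c \<bullet> w) + t\<^sup>2 * (w \<bullet> w)) - l \<bullet> c - t * (l \<bullet> w))"
    unfolding power2_norm_eq_inner
    by (simp add: fun_eq_iff inner_simps inner_commute power2_eq_square algebra_simps)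
  show ?thesis unfolding eq
    by (rule derivative_eq_intros refl | simp)+
      (simp add: inner_simps inner_commute algebra_simps)
qed

lemma lqp_line_derivative:
  fixes u v z :: "real^'m::finite"
  assumes v: "v \<in> pos_orthant J" and z: "z \<in> pos_orthant J" and u: "u \<in> nonneg_orthant J"
  shows "((\<lambda>t. \<Sum>j\<in>J. (v $ j + t * (u $ j - v $ j) - z $ j)\<^sup>2 / 2
            + \<mu> * ((z $ j)\<^sup>2 * ln (z $ j / (v $ j + t * (u $ j - v $ j))) + (v $ j + t * (u $ j - v $ j)) * z $ j - (z $ j)\<^sup>2))
    has_real_derivative
      (\<Sum>j\<in>J. (u $ j - v $ j) * (v $ j - z $ j + \<mu> * (z $ j - (z $ j)\<^sup>2 / v $ j)))) (at 0)"
proof (rule DERIV_sum)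
  fix j assume "j \<in> J"
  then have p: "v $ j > 0" "z $ j > 0"
    using v z by (auto simp: pos_orthant_def)
  then show "((\<lambda>t. (v $ j + t * (u $ j - v $ j) - z $ j)\<^sup>2 / 2
            + \<mu> * ((z $ j)\<^sup>2 * ln (z $ j / (v $ j + t * (u $ j - v $ j))) + (v $ j + t * (u $ j - v $ j)) * z $ j - (z $ j)\<^sup>2))
     has_real_derivative (u $ j - v $ j) * (v $ j - z $ j + \<mu> * (z $ j - (z $ j)\<^sup>2 / v $ j))) (at 0)"
    by (auto intro!: derivative_eq_intros simp: field_simps power2_eq_square)
qed

text \<open>Coordinatewise, the right side minus the left side is \<mu> times
  \<open>u $ j * (v $ j - z $ j)\<^sup>2 / v $ j\<close>, which is nonnegative because
  \<open>u\<close> is. This replaces the logarithmic gradient by inner products that can be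
  telescoped like a quadratic proximal term.\<close>

lemma lqp_gradient_le:
  fixes u v z :: "real^'m::finite"
  assumes v: "v \<in> pos_orthant J" and z: "z \<in> pos_orthant J" and u: "u \<in> nonneg_orthant J" and \<mu>: "0 \<le> \<mu>"
  shows "(\<Sum>j\<in>J. (u $ j - v $ j) * (v $ j - z $ j + \<mu> * (z $ j - (z $ j)\<^sup>2 / v $ j)))
    \<le> (u - v) \<bullet> (v - z) + \<mu> * ((v - z) \<bullet> (u - z))"
proof -
  have J: "(\<Sum>j\<in>J. p $ j * q $ j) = p \<bullet> q" if "\<And>j. j \<notin> J \<Longrightarrow> p $ j = 0" for p q :: "real^'m"
    unfolding inner_vec_def inner_real_def using that by (intro sum.mono_neutral_left) auto
  have *: "(u $ j - v $ j) * (v $ j - z $ j + \<mu> * (z $ j - (z $ j)\<^sup>2 / v $ j))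
    \<le> (u - v) $ j * (v - z) $ j + \<mu> * ((v - z) $ j * (u - z) $ j)" if "j \<in> J" for j
  proof -
    have p: "v $ j > 0" "z $ j > 0" "u $ j \<ge> 0"
      using that v z u by (auto simp: pos_orthant_def nonneg_orthant_def)
    have "(v $ j - z $ j) * (u $ j - z $ j) - (u $ j - v $ j) * (z $ j - (z $ j)\<^sup>2 / v $ j)
      = u $ j * (v $ j - z $ j)\<^sup>2 / v $ j"
      using p by (simp add: field_simps power2_eq_square)
    also have "\<dots> \<ge> 0" using p by simp
    finally have "\<mu> * ((u $ j - v $ j) * (z $ j - (z $ j)\<^sup>2 / v $ j))
      \<le> \<mu> * ((v $ j - z $ j) * (u $ j - z $ j))"
      using \<mu> by (intro mult_left_mono) auto
    then show ?thesis by (simp add: algebra_simps)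
  qed
  have "(\<Sum>j\<in>J. (u $ j - v $ j) * (v $ j - z $ j + \<mu> * (z $ j - (z $ j)\<^sup>2 / v $ j)))
    \<le> (\<Sum>j\<in>J. (u - v) $ j * (v - z) $ j + \<mu> * ((v - z) $ j * (u - z) $ j))"
    by (rule sum_mono) (rule *)
  also have "\<dots> = (\<Sum>j\<in>J. (u - v) $ j * (v - z) $ j) + \<mu> * (\<Sum>j\<in>J. (v - z) $ j * (u - z) $ j)"
    by (simp only: sum.distrib sum_distrib_left)
  also have "\<dots> = (u - v) \<bullet> (v - z) + \<mu> * ((v - z) \<bullet> (u - z))"
    using u v z by (subst (1 2) J) (auto simp: pos_orthant_def nonneg_orthant_def)
  finally show ?thesis .
qed

lemma pos_orthant_subset: "pos_orthant J \<subseteq> nonneg_orthant J"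
  by (auto simp: pos_orthant_def nonneg_orthant_def intro: less_imp_le)

lemma pos_orthant_segment:
  assumes v: "v \<in> pos_orthant J" and u: "u \<in> nonneg_orthant J" and t: "0 \<le> t" "t < 1"
  shows "(1 - t) *\<^sub>R v + t *\<^sub>R u \<in> pos_orthant J"
  using assms by (auto simp: pos_orthant_def nonneg_orthant_def intro!: add_pos_nonneg mult_pos_pos mult_nonneg_nonneg)

lemma residual_replace_block:
  "residual A B b (replace_block x i u) y = residual A B b x y + A i *v (u - x $ i)"
proof -
  have "(\<Sum>j\<in>UNIV. A j *v replace_block x i u $ j) = (\<Sum>j\<in>UNIV. A j *v x $ j + (if j = i then A i *v (u - x $ i) else 0))"
    by (intro sum.cong) (auto simp: replace_block_def matrix_vector_mult_diff_distrib)
  then show ?thesis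
    by (simp add: residual_def sum.distrib)
qed

lemma objective_replace_block:
  "objective f g (replace_block x i u) y = f i u + ((\<Sum>j\<in>-{i}. f j (x $ j)) + g y)"
proof -
  have "(\<Sum>j\<in>UNIV. f j (replace_block x i u $ j))
    = f i (replace_block x i u $ i) + (\<Sum>j\<in>UNIV-{i}. f j (replace_block x i u $ j))"
    by (rule sum.remove) auto
  also have "(\<Sum>j\<in>UNIV-{i}. f j (replace_block x i u $ j)) = (\<Sum>j\<in>-{i}. f j (x $ j))"
    by (rule sum.cong) (auto simp: replace_block_def)
  finally show ?thesis by (simp add: objective_def replace_block_def)
qed

lemma residual_diff:
  "residual A B b x y - residual A B b x' y'
    = (\<Sum>i\<in>UNIV. A i *v (x $ i - x' $ i)) + B *v (y - y')"
  by (simp add: residual_def matrix_vector_mult_diff_distrib sum_subtractf)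

lemma transpose_inner: "w \<bullet> (transpose M *v l) = (M *v w) \<bullet> l" for M :: "real^'m::finite^'n::finite"
  by (metis dot_lmul_matrix inner_commute transpose_matrix_vector)

text \<open>Cauchy-Schwarz applied to \<open>u\<close> and the Gram matrix times \<open>u\<close>;
  in this form the lower bound on \<open>r i\<close> dominates the norms of the block
  images.\<close>

lemma norm_matrix_vector_square_le:
  fixes M :: "real^'m::finite^'n::finite"
  shows "(norm (M *v u))\<^sup>2 \<le> onorm ((*v) (transpose M ** M)) * (norm u)\<^sup>2"
proof -
  have "(norm (M *v u))\<^sup>2 = u \<bullet> ((transpose M ** M) *v u)"
    by (simp only: power2_norm_eq_inner transpose_inner flip: matrix_vector_mul_assoc)
  also have "\<dots> \<le> norm u * norm ((transpose M ** M) *v u)" by (rule norm_cauchy_schwarz)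
  also have "\<dots> \<le> norm u * (onorm ((*v) (transpose M ** M)) * norm u)"
    by (intro mult_left_mono onorm) auto
  finally show ?thesis by (simp add: power2_eq_square mult_ac)
qed

lemma norm_sum_square_le:
  fixes a :: "'p::finite \<Rightarrow> 'a::real_normed_vector"
  shows "(norm (\<Sum>i\<in>UNIV. a i))\<^sup>2 \<le> real CARD('p) * (\<Sum>i\<in>UNIV. (norm (a i))\<^sup>2)"
proof -
  have "(norm (\<Sum>i\<in>UNIV. a i))\<^sup>2 \<le> (\<Sum>i\<in>UNIV. norm (a i))\<^sup>2"
    by (intro power_mono norm_sum) auto
  also have "\<dots> \<le> (\<Sum>i\<in>UNIV. (norm (a i))\<^sup>2) * real CARD('p)"
    by (rule sum_squared_le_sum_of_squares)
  finally show ?thesis by (simp add: mult.commute)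
qed

lemma norm_vec_square: "(norm v)\<^sup>2 = (\<Sum>i\<in>UNIV. (norm (v $ i))\<^sup>2)" for v :: "'a::real_normed_vector^'n::finite"
  by (simp add: norm_vec_def L2_set_def sum_nonneg)

text \<open>Closedness of the epigraph yields membership of the limit in the domain and lower
  semicontinuity at once. The moving bound \<open>c n\<close> lets optimality conditions pass to the
  limit although \<open>f\<close> need not be continuous.\<close>

lemma closed_epigraph_limit:
  assumes "closed (epigraph S f)" and "\<And>n. u n \<in> S" and "\<And>n. f (u n) \<le> c n"
    and "u \<longlonglongrightarrow> u'" and "c \<longlonglongrightarrow> c'"
  shows "u' \<in> S \<and> f u' \<le> c'"
proof -
  have "(u', c') \<in> epigraph S f"
    using closed_sequentially[OF assms(1), of "\<lambda>n. (u n, c n)" "(u', c')"] assms(2-)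
    by (auto simp: mem_epigraph intro: tendsto_Pair)
  then show ?thesis by (simp add: mem_epigraph)
qed

lemma descent_imp_tendsto_0:
  fixes V d :: "nat \<Rightarrow> real"
  assumes "\<And>k. 0 \<le> V k" "\<And>k. 0 \<le> d k" "\<And>k. V (Suc k) \<le> V k - d k"
  shows "d \<longlonglongrightarrow> 0"
proof -
  have "decseq V" by (rule decseq_SucI) (metis assms(2,3) diff_ge_0_iff_ge diff_left_mono diff_zero order_trans)
  with assms(1) obtain L where L: "V \<longlonglongrightarrow> L" by (metis decseq_convergent)
  have "(\<lambda>k. V k - V (Suc k)) \<longlonglongrightarrow> L - L"
    by (intro tendsto_diff L LIMSEQ_Suc)
  then have lim: "(\<lambda>k. V k - V (Suc k)) \<longlonglongrightarrow> 0" by simp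
  have "d k \<le> V k - V (Suc k)" for k using assms(3)[of k] by simp
  with assms(2) show ?thesis
    by (intro real_tendsto_sandwich[OF _ _ tendsto_const lim]) auto
qed

lemma tendsto_matrix_vector: "(u \<longlongrightarrow> u') F \<Longrightarrow> ((\<lambda>n. M *v u n) \<longlongrightarrow> M *v u') F"
  for M :: "real^'c::finite^'e::finite"
  by (rule bounded_linear.tendsto[OF matrix_vector_mul_bounded_linear])

text \<open>Scalar core of the descent estimate, with \<rho> and \<sigma> the inner products of the
  new and old residual with the y-step image, and \<open>D\<close>, \<open>m\<close> the squared
  norms of that image and of the old residual. Multiplying the first hypothesis by
  \<open>2 * (1 - \<alpha>)\<close> and adding \<open>pos\<close> eliminates \<sigma>; the
  coefficients of \<open>D\<close> combine to
  \<open>(1 - \<alpha>) * (1 + \<alpha>)\<close>.\<close>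

lemma relaxation_bound:
  fixes \<alpha> \<tau> :: real
  assumes a: "0 < 1 + \<alpha>" "\<alpha> < 1" and \<rho>: "(1 + \<alpha>) * \<rho> \<le> (1 - \<tau>) * \<sigma> + \<alpha> * D"
    and pos: "0 \<le> (1 - \<tau>)\<^sup>2 * m - 2 * (1 - \<tau>) * (1 - \<alpha>) * \<sigma> + (1 - \<alpha>)\<^sup>2 * D"
  shows "(1 - \<alpha>) * \<rho> - (1 - \<alpha>) / 2 * D \<le> (1 - \<tau>)\<^sup>2 / (2 * (1 + \<alpha>)) * m"
proof -
  have "0 \<le> 2 * (1 - \<alpha>) * ((1 - \<tau>) * \<sigma> + \<alpha> * D - (1 + \<alpha>) * \<rho>)"
    using a \<rho> by simp
  also have "\<dots> \<le> (1 - \<tau>)\<^sup>2 * m - 2 * (1 + \<alpha>) * ((1 - \<alpha>) * \<rho> - (1 - \<alpha>) / 2 * D)"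
    using pos by (simp add: power2_eq_square field_simps)
  finally show ?thesis using a by (simp add: field_simps)
qed

subsection \<open>Optimality conditions along the iteration\<close>

locale admm_lqp_iteration =
  fixes I :: "'p::finite \<Rightarrow> 'm::finite set"
    and A :: "'p \<Rightarrow> real^'m^'n::finite"
    and B :: "real^'d::finite^'n"
    and b :: "real^'n"
    and f :: "'p \<Rightarrow> real^'m \<Rightarrow> real"
    and g :: "real^'d \<Rightarrow> real"
    and Y :: "(real^'d) set"
    and \<beta> \<mu> \<alpha> \<tau> \<gamma> :: real
    and r :: "'p \<Rightarrow> real"
    and x :: "nat \<Rightarrow> (real^'m)^'p"
    and y :: "nat \<Rightarrow> real^'d"
    and l :: "nat \<Rightarrow> real^'n"
  assumes rank_B: "rank B = CARD('d)"
    and f_closed_convex: "\<And>i. closed_proper_convex_on (nonneg_orthant (I i)) (f i)"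
    and g_closed_convex: "closed_proper_convex_on UNIV g"
    and closed_Y: "closed Y" and convex_Y: "convex Y"
    and \<beta>_pos: "\<beta> > 0" and \<mu>_pos: "0 < \<mu>" and \<mu>_less: "\<mu> < 1"
    and step_sizes: "(\<alpha>, \<tau>) \<in> step_region"
    and r_pos: "\<And>i. r i > 0"
    and \<gamma>_greater: "\<gamma> > (real CARD('p) - 1) / (1 - \<mu>)"
    and r_ge: "\<And>i. r i \<ge> \<gamma> * \<beta> * onorm ((*v) (transpose (A i) ** A i))"
    and admm: "admm_lqp I A B b f g Y \<beta> \<mu> r \<alpha> \<tau> x y l"
begin

definition res :: "nat \<Rightarrow> real^'n" where
  "res k = residual A B b (x k) (y k)"

definition half_res :: "nat \<Rightarrow> real^'n" where
  "half_res k = residual A B b (x (Suc k)) (y k)"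

definition half_l :: "nat \<Rightarrow> real^'n" where
  "half_l k = l k - (\<alpha> * \<beta>) *\<^sub>R half_res k"

lemma step_size_bounds:
  shows "-1 < \<alpha>" "\<alpha> < 1" "0 < \<alpha> + \<tau>" "0 < 1 + \<alpha> + \<tau> - \<alpha> * \<tau> - \<alpha>\<^sup>2 - \<tau>\<^sup>2"
  using step_sizes by (auto simp: step_region_def)

lemma x_0_pos: "x 0 $ i \<in> pos_orthant (I i)"
  using admm by (simp add: admm_lqp_def)

lemma x_arg_min:
  "is_arg_min
     (\<lambda>u. ereal (aug_lagrangian A B b f g \<beta> (replace_block (x k) i u) (y k) (l k))
       + ereal (r i) * lqp \<mu> (I i) u (x k $ i))
     (\<lambda>u. u \<in> nonneg_orthant (I i)) (x (Suc k) $ i)"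
  using admm by (simp add: admm_lqp_def)

lemma y_arg_min:
  "is_arg_min (\<lambda>v. aug_lagrangian A B b f g \<beta> (x (Suc k)) v (half_l k)) (\<lambda>v. v \<in> Y) (y (Suc k))"
  using admm by (simp add: admm_lqp_def Let_def half_l_def half_res_def)

lemma y_in_Y: "y (Suc k) \<in> Y"
  using y_arg_min by (simp add: is_arg_min_def)

lemma l_Suc: "l (Suc k) = half_l k - (\<tau> * \<beta>) *\<^sub>R res (Suc k)"
  using admm by (simp add: admm_lqp_def Let_def half_l_def half_res_def res_def)

text \<open>The previous iterate is a competitor with finite objective value, while
  \<open>lqp\<close> is infinite off the open orthant and \<open>r i > 0\<close> keeps the product
  infinite; so a minimizer cannot leave the open orthant.\<close>

lemma x_pos: "x k $ i \<in> pos_orthant (I i)"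
proof (induction k)
  case (Suc k)
  show ?case
  proof (rule ccontr)
    assume "x (Suc k) $ i \<notin> pos_orthant (I i)"
    moreover have "x k $ i \<in> nonneg_orthant (I i)" using Suc pos_orthant_subset by blast
    ultimately show False
      using x_arg_min[of k i] Suc r_pos[of i]
      by (auto simp: is_arg_min_def lqp_def dest!: spec[of _ "x k $ i"])
  qed
qed (rule x_0_pos)

lemma x_nonneg: "x k $ i \<in> nonneg_orthant (I i)"
  using x_pos pos_orthant_subset by blast

text \<open>The parallel update of block \<open>i\<close> sees the other blocks at their old values,
  whereas \<open>half_res k\<close> uses all new blocks. The sum over the remaining blocks corrects
  this mismatch and is the source of \<open>coupling\<close>. The last summand is the bound from
  \<open>lqp_gradient_le\<close>, not the exact gradient.\<close>

lemma x_variational_inequality: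
  assumes u: "u \<in> nonneg_orthant (I i)"
  shows "0 \<le> f i u - f i (x (Suc k) $ i)
    + (A i *v (u - x (Suc k) $ i)) \<bullet>
        (\<beta> *\<^sub>R (half_res k + (\<Sum>j\<in>UNIV - {i}. A j *v (x k $ j - x (Suc k) $ j))) - l k)
    + r i * ((u - x (Suc k) $ i) \<bullet> (x (Suc k) $ i - x k $ i)
        + \<mu> * ((x (Suc k) $ i - x k $ i) \<bullet> (u - x k $ i)))"
proof -
  define v where "v = x (Suc k) $ i"
  define z where "z = x k $ i"
  define c where "c = residual A B b (replace_block (x k) i v) (y k)"
  define w where "w = A i *v (u - v)"
  \<comment> \<open>The real value of the regularizer along the segment from \<open>v\<close> to
    \<open>u\<close>.\<close>
  define h where "h t = (\<Sum>j\<in>I i. (v $ j + t * (u $ j - v $ j) - z $ j)\<^sup>2 / 2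
    + \<mu> * ((z $ j)\<^sup>2 * ln (z $ j / (v $ j + t * (u $ j - v $ j)))
        + (v $ j + t * (u $ j - v $ j)) * z $ j - (z $ j)\<^sup>2))" for t
  define D where "D = (\<Sum>j\<in>I i. (u $ j - v $ j) * (v $ j - z $ j + \<mu> * (z $ j - (z $ j)\<^sup>2 / v $ j)))"
  \<comment> \<open>The part of the objective independent of block \<open>i\<close>; it cancels in
    the comparison.\<close>
  define K where "K = (\<Sum>j\<in>-{i}. f j (x k $ j)) + g (y k)"
  have v: "v \<in> pos_orthant (I i)" and z: "z \<in> pos_orthant (I i)"
    unfolding v_def z_def by (rule x_pos)+
  have c: "c = half_res k + (\<Sum>j\<in>UNIV - {i}. A j *v (x k $ j - x (Suc k) $ j))"
  proof -
    have "c - half_res k = (\<Sum>j\<in>UNIV. A j *v (replace_block (x k) i v $ j - x (Suc k) $ j))"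
      by (simp add: c_def half_res_def residual_diff)
    also have "\<dots> = (\<Sum>j\<in>UNIV - {i}. A j *v (replace_block (x k) i v $ j - x (Suc k) $ j))"
      by (intro sum.mono_neutral_right) (auto simp: replace_block_def v_def)
    also have "\<dots> = (\<Sum>j\<in>UNIV - {i}. A j *v (x k $ j - x (Suc k) $ j))"
      by (intro sum.cong) (auto simp: replace_block_def)
    finally show ?thesis by (simp add: algebra_simps)
  qed
  let ?obj = "\<lambda>p. ereal (aug_lagrangian A B b f g \<beta> (replace_block (x k) i p) (y k) (l k))
       + ereal (r i) * lqp \<mu> (I i) p z"
  let ?\<phi> = "\<lambda>t. \<beta> / 2 * (norm (c + t *\<^sub>R w))\<^sup>2 - l k \<bullet> (c + t *\<^sub>R w) + r i * h t"
  \<comment> \<open>Since \<open>u\<close> may lie on the boundary, \<open>t < 1\<close> is what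
    keeps the segment in the open orthant, where the regularizer is finite.\<close>
  have obj: "?obj ((1 - t) *\<^sub>R v + t *\<^sub>R u) = ereal (f i ((1 - t) *\<^sub>R v + t *\<^sub>R u) + ?\<phi> t + K)"
    if t: "0 \<le> t" "t < 1" for t
  proof -
    let ?p = "(1 - t) *\<^sub>R v + t *\<^sub>R u"
    have p: "?p = v + t *\<^sub>R (u - v)" by (simp add: algebra_simps)
    have "residual A B b (replace_block (x k) i ?p) (y k) = c + t *\<^sub>R w"
      unfolding c_def w_def residual_replace_block p
      by (simp add: algebra_simps matrix_vector_mult_scaleR)
    then have "aug_lagrangian A B b f g \<beta> (replace_block (x k) i ?p) (y k) (l k)
      = f i ?p + K + (\<beta> / 2 * (norm (c + t *\<^sub>R w))\<^sup>2 - l k \<bullet> (c + t *\<^sub>R w))"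
      by (simp add: aug_lagrangian_def objective_replace_block K_def)
    moreover have "lqp \<mu> (I i) ?p z = ereal (h t)"
      using pos_orthant_segment[OF v u t] unfolding lqp_def h_def p by simp
    ultimately show ?thesis by simp
  qed
  have "0 \<le> f i u - f i v + (w \<bullet> (\<beta> *\<^sub>R c - l k) + r i * D)"
  proof (rule first_order_optimality[of "nonneg_orthant (I i)" _ _ _ ?\<phi>])
    show "convex_on (nonneg_orthant (I i)) (f i)"
      using f_closed_convex by (simp add: closed_proper_convex_on_def)
    show "v \<in> nonneg_orthant (I i)" using v pos_orthant_subset by blast
    show "u \<in> nonneg_orthant (I i)" by (rule u)
    show "(?\<phi> has_real_derivative w \<bullet> (\<beta> *\<^sub>R c - l k) + r i * D) (at 0)"
      unfolding h_def D_def
      by (intro DERIV_add DERIV_cmult quadratic_line_derivative lqp_line_derivative v z u)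
    fix t :: real assume t: "0 < t" "t < 1"
    then have "(1 - t) *\<^sub>R v + t *\<^sub>R u \<in> nonneg_orthant (I i)"
      using pos_orthant_segment[OF v u, of t] pos_orthant_subset by auto
    then have "\<not> ?obj ((1 - t) *\<^sub>R v + t *\<^sub>R u) < ?obj v"
      using x_arg_min[of k i] unfolding is_arg_min_def v_def z_def by blast
    moreover have "?obj v = ereal (f i v + ?\<phi> 0 + K)"
      using obj[of 0] by simp
    ultimately show "f i v + ?\<phi> 0 \<le> f i ((1 - t) *\<^sub>R v + t *\<^sub>R u) + ?\<phi> t"
      using obj[of t] t by simp
  qed
  moreover have "r i * D \<le> r i * ((u - v) \<bullet> (v - z) + \<mu> * ((v - z) \<bullet> (u - z)))"
    unfolding D_def using r_pos[of i] \<mu>_pos by (intro mult_left_mono lqp_gradient_le v z u) auto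
  ultimately show ?thesis
    unfolding c w_def v_def z_def by linarith
qed

lemma y_variational_inequality:
  assumes v: "v \<in> Y"
  shows "0 \<le> g v - g (y (Suc k))
    + (B *v (v - y (Suc k))) \<bullet> (\<beta> *\<^sub>R res (Suc k) - half_l k)"
proof -
  let ?w = "B *v (v - y (Suc k))" and ?c = "res (Suc k)"
  let ?\<phi> = "\<lambda>t. \<beta> / 2 * (norm (?c + t *\<^sub>R ?w))\<^sup>2 - half_l k \<bullet> (?c + t *\<^sub>R ?w)"
  have obj: "aug_lagrangian A B b f g \<beta> (x (Suc k)) ((1 - t) *\<^sub>R y (Suc k) + t *\<^sub>R v) (half_l k)
    = g ((1 - t) *\<^sub>R y (Suc k) + t *\<^sub>R v) + ?\<phi> t + (\<Sum>i\<in>UNIV. f i (x (Suc k) $ i))" for t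
  proof -
    have "residual A B b (x (Suc k)) ((1 - t) *\<^sub>R y (Suc k) + t *\<^sub>R v) = ?c + t *\<^sub>R ?w"
      by (simp add: res_def residual_def algebra_simps matrix_vector_mult_scaleR)
    then show ?thesis by (simp add: aug_lagrangian_def objective_def)
  qed
  show ?thesis
  proof (rule first_order_optimality[of Y _ _ _ ?\<phi>])
    show "convex_on Y g"
      using g_closed_convex convex_Y convex_on_subset[of UNIV g Y]
      by (simp add: closed_proper_convex_on_def)
    fix t :: real assume t: "0 < t" "t < 1"
    then have "(1 - t) *\<^sub>R y (Suc k) + t *\<^sub>R v \<in> Y"
      by (intro convexD[OF convex_Y y_in_Y v]) auto
    then show "g (y (Suc k)) + ?\<phi> 0 \<le> g ((1 - t) *\<^sub>R y (Suc k) + t *\<^sub>R v) + ?\<phi> t"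
      using y_arg_min[of k] obj[of t] obj[of 0] by (auto simp: is_arg_min_def not_less)
  qed (rule y_in_Y v quadratic_line_derivative)+
qed

subsection \<open>A Lyapunov function\<close>

definition weight :: "(real^'m)^'p \<Rightarrow> real" where
  "weight u = (\<Sum>i\<in>UNIV. r i * (norm (u $ i))\<^sup>2)"

text \<open>Expanding the square leaves -\<beta> times the sum of the inner products of distinct
  block images: the indefinite price of updating the blocks in parallel.\<close>

definition coupling :: "(real^'m)^'p \<Rightarrow> real" where
  "coupling u = \<beta> * ((\<Sum>i\<in>UNIV. (norm (A i *v u $ i))\<^sup>2) - (norm (\<Sum>i\<in>UNIV. A i *v u $ i))\<^sup>2)"

text \<open>The factors \<open>1 - \<mu>\<close> here and \<open>1 + \<mu>\<close> in
  \<open>block_potential\<close> come from polarizing the two inner products in the bound on the LQP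
  gradient: the first weights the step length, the second the distance to the solution.\<close>

definition block_gap :: "(real^'m)^'p \<Rightarrow> real" where
  "block_gap u = ((1 - \<mu>) * weight u + coupling u) / 2"

definition block_potential :: "(real^'m)^'p \<Rightarrow> real" where
  "block_potential u = ((1 + \<mu>) * weight u + coupling u) / 2"

lemma weight_nonneg: "0 \<le> weight u"
  by (simp add: weight_def sum_nonneg r_pos less_imp_le)

lemma weight_ge_norm:
  obtains c where "0 < c" "\<And>u. c * (norm u)\<^sup>2 \<le> weight u"
proof
  show "0 < Min (range r)" using r_pos by simp
  show "Min (range r) * (norm u)\<^sup>2 \<le> weight u" for u
    unfolding weight_def norm_vec_square sum_distrib_left
    by (intro sum_mono mult_right_mono) auto
qed

text \<open>Full column rank makes \<open>B\<close> injective, so estimates on images under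
  \<open>B\<close> carry back to the y-variables.\<close>

lemma B_bounded_below:
  obtains c where "0 < c" "\<And>v. c * norm v \<le> norm (B *v v)"
proof -
  have "inj ((*v) B)"
    using rank_B full_rank_injective[of B] by simp
  then show thesis
    by (rule linear_inj_bounded_below_pos[OF matrix_vector_mul_linear]) (rule that)
qed

text \<open>With \<open>s\<close> the sum of the squared block images,
  \<open>norm_sum_square_le\<close> gives \<open>coupling u \<ge> - (p - 1) * \<beta> * s\<close>,
  and the bound on \<open>r i\<close> gives \<open>\<beta> * s \<le> weight u / \<gamma>\<close>.
  The remaining factor \<open>1 - \<mu> - (p - 1) / \<gamma>\<close> is positive exactly by the
  hypothesis on \<gamma>, which also forces \<gamma> to be positive.\<close>

lemma block_gap_coercive:
  obtains c where "0 < c" "\<And>u. c * (norm u)\<^sup>2 \<le> block_gap u"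
proof -
  let ?p = "real CARD('p)" let ?c = "1 - \<mu> - (?p - 1) / \<gamma>"
  have p: "?p \<ge> 1" by (simp add: Suc_leI)
  with \<gamma>_greater \<mu>_less have \<gamma>: "\<gamma> > 0"
    by (smt (verit) divide_nonneg_pos)
  have c: "?c > 0" using \<gamma>_greater \<mu>_less \<gamma> by (simp add: field_simps)
  have "?c * weight u \<le> (1 - \<mu>) * weight u + coupling u" for u
  proof -
    let ?s = "\<Sum>i\<in>UNIV. (norm (A i *v u $ i))\<^sup>2"
    have "\<gamma> * (\<beta> * ?s) = (\<Sum>i\<in>UNIV. \<gamma> * \<beta> * (norm (A i *v u $ i))\<^sup>2)"
      by (simp add: sum_distrib_left mult.assoc)
    also have "\<dots> \<le> weight u"
      unfolding weight_def
    proof (rule sum_mono)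
      fix i
      have "\<gamma> * \<beta> * (norm (A i *v u $ i))\<^sup>2
        \<le> \<gamma> * \<beta> * (onorm ((*v) (transpose (A i) ** A i)) * (norm (u $ i))\<^sup>2)"
        using \<gamma> \<beta>_pos by (intro mult_left_mono norm_matrix_vector_square_le) auto
      also have "\<dots> \<le> r i * (norm (u $ i))\<^sup>2"
        using mult_right_mono[OF r_ge, of "(norm (u $ i))\<^sup>2" i] by (simp add: mult.assoc)
      finally show "\<gamma> * \<beta> * (norm (A i *v u $ i))\<^sup>2 \<le> r i * (norm (u $ i))\<^sup>2" .
    qed
    finally have "\<beta> * ?s \<le> weight u / \<gamma>" using \<gamma> by (simp add: field_simps)
    then have "(?p - 1) * (\<beta> * ?s) \<le> (?p - 1) * (weight u / \<gamma>)"
      using p by (intro mult_left_mono) auto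
    moreover have "\<beta> * (norm (\<Sum>i\<in>UNIV. A i *v u $ i))\<^sup>2 \<le> \<beta> * (?p * ?s)"
      using \<beta>_pos by (intro mult_left_mono norm_sum_square_le) auto
    ultimately show ?thesis by (simp add: coupling_def algebra_simps)
  qed
  moreover obtain c' where c': "0 < c'" "\<And>u. c' * (norm u)\<^sup>2 \<le> weight u"
    by (rule weight_ge_norm) blast
  ultimately have "?c * c' / 2 * (norm u)\<^sup>2 \<le> block_gap u" for u
    using mult_left_mono[OF c'(2)[of u], of ?c] c unfolding block_gap_def by (smt (verit) mult.assoc mult.commute times_divide_eq_left divide_right_mono)
  then show thesis using that[of "?c * c' / 2"] c c'(1) by simp
qed

lemma block_gap_nonneg: "0 \<le> block_gap u"
proof -
  obtain c where c: "0 < c" "\<And>u. c * (norm u)\<^sup>2 \<le> block_gap u"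
    by (rule block_gap_coercive) blast
  have "0 \<le> c * (norm u)\<^sup>2" using c(1) by simp
  also have "\<dots> \<le> block_gap u" by (rule c(2))
  finally show ?thesis .
qed

lemma block_gap_le_potential: "block_gap u \<le> block_potential u"
  using mult_nonneg_nonneg[OF _ weight_nonneg, of \<mu> u] \<mu>_pos
  by (simp add: block_gap_def block_potential_def algebra_simps)

section \<open>Solutions of the variational inequality as saddle points\<close>

text \<open>Moving the transposes across the inner product merges the x- and y-components of
  \<open>J_map\<close> into one pairing of \<open>ls\<close> with a difference of residuals.\<close>

lemma W_star_iff:
  "(xs, ys, ls) \<in> W_star I A B b f g Y \<longleftrightarrow>
    xs \<in> X_set I \<and> ys \<in> Y \<and>
    (\<forall>u\<in>X_set I. \<forall>v\<in>Y. \<forall>m. 0 \<le> objective f g u v - objective f g xs ys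
      + ((m - ls) \<bullet> residual A B b xs ys - ls \<bullet> (residual A B b u v - residual A B b xs ys)))"
proof -
  have vec: "p \<bullet> (\<chi> i. z i) = (\<Sum>i\<in>UNIV. p $ i \<bullet> z i)" for p :: "(real^'m)^'p" and z
    by (simp add: inner_vec_def)
  have "(u - xs, v - ys, m - ls) \<bullet> J_map A B b (xs, ys, ls)
    = (m - ls) \<bullet> residual A B b xs ys - ls \<bullet> (residual A B b u v - residual A B b xs ys)" for u v m
    by (simp add: J_map_def vec transpose_inner sum_negf residual_diff inner_add_right inner_sum_right
        inner_commute[of _ ls] del: transpose_matrix_vector)
  then show ?thesis
    by (simp add: W_star_def VI_solutions_def W_set_def \<Theta>_fun_def)
qed

lemma W_starI:
  assumes xs: "xs \<in> X_set I" and ys: "ys \<in> Y" and res: "residual A B b xs ys = 0"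
    and f: "\<And>i u. u \<in> nonneg_orthant (I i) \<Longrightarrow> 0 \<le> f i u - f i (xs $ i) - (A i *v (u - xs $ i)) \<bullet> ls"
    and g: "\<And>v. v \<in> Y \<Longrightarrow> 0 \<le> g v - g ys - (B *v (v - ys)) \<bullet> ls"
  shows "(xs, ys, ls) \<in> W_star I A B b f g Y"
proof -
  have "0 \<le> objective f g u v - objective f g xs ys - ls \<bullet> (residual A B b u v - residual A B b xs ys)"
    if u: "u \<in> X_set I" and v: "v \<in> Y" for u v
  proof -
    have "0 \<le> (\<Sum>i\<in>UNIV. f i (u $ i) - f i (xs $ i) - (A i *v (u $ i - xs $ i)) \<bullet> ls)"
      using u by (intro sum_nonneg f) (auto simp: X_set_def)
    with g[OF v] show ?thesis
      by (simp add: objective_def residual_diff inner_add_right inner_sum_right inner_commute[of ls] sum_subtractf)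
  qed
  with xs ys res show ?thesis by (simp add: W_star_iff)
qed

lemma W_starD:
  assumes "(xs, ys, ls) \<in> W_star I A B b f g Y"
  shows "xs $ i \<in> nonneg_orthant (I i)" "ys \<in> Y" "residual A B b xs ys = 0"
    and "u \<in> X_set I \<Longrightarrow> v \<in> Y \<Longrightarrow> 0 \<le> objective f g u v - objective f g xs ys - ls \<bullet> residual A B b u v"
proof -
  show xs: "xs $ i \<in> nonneg_orthant (I i)" and ys: "ys \<in> Y"
    using assms by (auto simp: W_star_iff X_set_def)
  have *: "0 \<le> objective f g u v - objective f g xs ys
      + ((m - ls) \<bullet> residual A B b xs ys - ls \<bullet> (residual A B b u v - residual A B b xs ys))"
    if "u \<in> X_set I" "v \<in> Y" for u v m
    using assms that by (simp add: W_star_iff)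
  \<comment> \<open>The multiplier component is unconstrained, so moving it against the residual
    while fixing \<open>xs\<close> and \<open>ys\<close> forces feasibility.\<close>
  have "0 \<le> - (residual A B b xs ys \<bullet> residual A B b xs ys)"
    using *[of xs ys "ls - residual A B b xs ys"] assms by (simp add: W_star_iff)
  then have "residual A B b xs ys \<bullet> residual A B b xs ys = 0"
    using inner_ge_zero[of "residual A B b xs ys"] by linarith
  then show res: "residual A B b xs ys = 0" by simp
  show "0 \<le> objective f g u v - objective f g xs ys - ls \<bullet> residual A B b u v"
    if "u \<in> X_set I" "v \<in> Y"
    using *[OF that, of ls] res by simp
qed

lemma res_Suc: "res (Suc k) = half_res k + B *v (y (Suc k) - y k)"
  by (simp add: res_def half_res_def residual_def matrix_vector_mult_diff_distrib)

text \<open>Each of two consecutive y-conditions is tested at the other minimizer; on addition the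
  values of \<open>g\<close> cancel. The indices start at \<open>Suc k\<close> because the starting
  point \<open>y 0\<close> need not satisfy any optimality condition, nor lie in
  \<open>Y\<close>.\<close>

lemma y_step_monotone:
  defines "\<delta> k \<equiv> B *v (y (Suc k) - y k)"
  shows "(1 + \<alpha>) * (res (Suc (Suc k)) \<bullet> \<delta> (Suc k))
    \<le> (1 - \<tau>) * (res (Suc k) \<bullet> \<delta> (Suc k)) + \<alpha> * (norm (\<delta> (Suc k)))\<^sup>2"
proof -
  define R R' d where "R = res (Suc k)" and "R' = res (Suc (Suc k))" and "d = \<delta> (Suc k)"
  have "0 \<le> - (d \<bullet> (\<beta> *\<^sub>R R' - half_l (Suc k))) + d \<bullet> (\<beta> *\<^sub>R R - half_l k)"
  proof -
    have "B *v (y (Suc k) - y (Suc (Suc k))) = - d"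
      by (simp add: d_def \<delta>_def matrix_vector_mult_diff_distrib)
    then show ?thesis
      using y_variational_inequality[OF y_in_Y[of k], of "Suc k"]
        y_variational_inequality[OF y_in_Y[of "Suc k"], of k]
      by (simp add: R_def R'_def d_def \<delta>_def)
  qed
  \<comment> \<open>Two multiplier updates combined; \<open>R' - d\<close> is the residual at the
    new x and old y.\<close>
  also have "half_l (Suc k) = half_l k - (\<tau> * \<beta>) *\<^sub>R R - (\<alpha> * \<beta>) *\<^sub>R (R' - d)"
    by (simp add: half_l_def[of "Suc k"] l_Suc res_Suc[of "Suc k"] R_def R'_def d_def \<delta>_def)
  finally have "0 \<le> \<beta> * ((1 - \<tau>) * (R \<bullet> d) - (1 + \<alpha>) * (R' \<bullet> d) + \<alpha> * (norm d)\<^sup>2)"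
    unfolding power2_norm_eq_inner
    by (simp add: inner_simps inner_commute algebra_simps)
  then show ?thesis
    using \<beta>_pos by (simp add: zero_le_mult_iff R_def R'_def d_def)
qed

end

section \<open>Descent relative to a fixed solution\<close>

text \<open>The solution is a locale parameter so that the Lyapunov function can be recentred: first
  at an arbitrary solution, later at a limit point of the iterates.\<close>

locale admm_lqp_saddle = admm_lqp_iteration I A B b f g Y \<beta> \<mu> \<alpha> \<tau> \<gamma> r x y l
  for I :: "'p::finite \<Rightarrow> 'm::finite set" and A :: "'p \<Rightarrow> real^'m^'n::finite"
    and B :: "real^'d::finite^'n" and b f g Y \<beta> \<mu> \<alpha> \<tau> \<gamma> r x y l +
  fixes xs :: "(real^'m)^'p" and ys :: "real^'d" and ls :: "real^'n"
  assumes saddle: "(xs, ys, ls) \<in> W_star I A B b f g Y"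
begin

definition \<eta> :: "nat \<Rightarrow> real^'n" where
  "\<eta> k = l k - ls - (\<alpha> * \<beta>) *\<^sub>R (B *v (y k - ys))"

definition potential :: "nat \<Rightarrow> real" where
  "potential k = block_potential (x k - xs)
    + 1 / (2 * (\<alpha> + \<tau>) * \<beta>) * (norm (\<eta> k))\<^sup>2 + (1 - \<alpha>) * \<beta> / 2 * (norm (B *v (y k - ys)))\<^sup>2"

lemma res_eq: "res k = (\<Sum>i\<in>UNIV. A i *v (x k $ i - xs $ i)) + B *v (y k - ys)"
  using residual_diff[of A B b "x k" "y k" xs ys] W_starD(3)[OF saddle] by (simp add: res_def)

text \<open>With \<open>q\<close> and \<open>q'\<close> the images under \<open>B\<close> of the old
  and new y-errors, the half step uses the residual \<open>res (Suc k) - q' + q\<close>; the shift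
  by \<alpha> \<beta> times the y-error image absorbs \<open>q\<close> and
  \<open>q'\<close>.\<close>

lemma \<eta>_Suc: "\<eta> (Suc k) = \<eta> k - ((\<alpha> + \<tau>) * \<beta>) *\<^sub>R res (Suc k)"
proof -
  define q q' where "q = B *v (y k - ys)" and "q' = B *v (y (Suc k) - ys)"
  have "B *v (y (Suc k) - y k) = q' - q"
    by (simp add: q_def q'_def matrix_vector_mult_diff_distrib)
  then have eq: "half_res k = res (Suc k) - q' + q"
    using res_Suc[of k] by simp
  show ?thesis
    unfolding \<eta>_def l_Suc half_l_def eq q_def[symmetric] q'_def[symmetric]
    by (simp add: algebra_simps)
qed

text \<open>The block conditions are tested at \<open>xs\<close> and summed. Polarization turns both
  the cross-block terms and the proximal terms into differences of quadratic forms at consecutive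
  errors, minus a form in the step itself.\<close>

lemma x_step_descent:
  "0 \<le> (\<Sum>i\<in>UNIV. f i (xs $ i)) - (\<Sum>i\<in>UNIV. f i (x (Suc k) $ i))
    - (res (Suc k) - B *v (y (Suc k) - ys)) \<bullet> (\<beta> *\<^sub>R half_res k - l k)
    + block_potential (x k - xs) - block_potential (x (Suc k) - xs) - block_gap (x k - x (Suc k))"
proof -
  define a a' where "a i = A i *v (x k $ i - xs $ i)" and "a' i = A i *v (x (Suc k) $ i - xs $ i)" for i
  define S S' where "S = sum a UNIV" and "S' = sum a' UNIV"
  let ?prox = "\<lambda>i. r i * ((xs $ i - x (Suc k) $ i) \<bullet> (x (Suc k) $ i - x k $ i)
        + \<mu> * ((x (Suc k) $ i - x k $ i) \<bullet> (xs $ i - x k $ i)))"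
  have diff: "A i *v (x k $ i - x (Suc k) $ i) = a i - a' i" for i
    by (simp add: a_def a'_def matrix_vector_mult_diff_distrib)
  have diff': "A i *v (xs $ i - x (Suc k) $ i) = - a' i" for i
    by (simp add: a'_def matrix_vector_mult_diff_distrib)
  have others: "(\<Sum>j\<in>UNIV - {i}. a j - a' j) = S - S' - (a i - a' i)" for i
    by (simp add: S_def S'_def sum_diff1 sum_subtractf)
  have "0 \<le> (\<Sum>i\<in>UNIV. f i (xs $ i) - f i (x (Suc k) $ i)
    + (- a' i) \<bullet> (\<beta> *\<^sub>R (half_res k + (S - S' - (a i - a' i))) - l k) + ?prox i)"
    using x_variational_inequality[OF W_starD(1)[OF saddle], of _ k]
    unfolding diff diff' others by (intro sum_nonneg) blast
  also have "\<dots> = (\<Sum>i\<in>UNIV. f i (xs $ i)) - (\<Sum>i\<in>UNIV. f i (x (Suc k) $ i))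
    - S' \<bullet> (\<beta> *\<^sub>R half_res k - l k)
    - \<beta> * (S' \<bullet> (S - S') - (\<Sum>i\<in>UNIV. a' i \<bullet> (a i - a' i))) + sum ?prox UNIV"
  proof -
    have "(- a' i) \<bullet> (\<beta> *\<^sub>R (half_res k + (S - S' - (a i - a' i))) - l k)
      = \<beta> * (a' i \<bullet> (a i - a' i)) - a' i \<bullet> (\<beta> *\<^sub>R half_res k - l k) - \<beta> * (a' i \<bullet> (S - S'))" for i
      by (simp add: inner_simps algebra_simps)
    moreover have "(\<Sum>i\<in>UNIV. a' i \<bullet> v) = S' \<bullet> v" for v
      by (simp add: S'_def inner_sum_left)
    ultimately show ?thesis
      by (simp add: sum.distrib sum_subtractf right_diff_distrib flip: sum_distrib_left)
  qed
  \<comment> \<open>The same polarization identity is applied to the total image \<open>S\<close>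
    and to each block image \<open>a i\<close>; subtracting the two recovers
    \<open>coupling\<close>.\<close>
  also have "\<beta> * (S' \<bullet> (S - S') - (\<Sum>i\<in>UNIV. a' i \<bullet> (a i - a' i)))
    = (coupling (x (Suc k) - xs) + coupling (x k - x (Suc k)) - coupling (x k - xs)) / 2"
  proof -
    have in2: "2 * (p' \<bullet> (p - p')) = (norm p)\<^sup>2 - (norm p')\<^sup>2 - (norm (p - p'))\<^sup>2" for p p' :: "real^'n"
      unfolding power2_norm_eq_inner by (simp add: inner_simps inner_commute)
    have "2 * (S' \<bullet> (S - S') - (\<Sum>i\<in>UNIV. a' i \<bullet> (a i - a' i)))
      = 2 * (S' \<bullet> (S - S')) - (\<Sum>i\<in>UNIV. 2 * (a' i \<bullet> (a i - a' i)))"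
      by (simp add: sum_distrib_left right_diff_distrib)
    also have "\<dots> = ((norm S)\<^sup>2 - (norm S')\<^sup>2 - (norm (S - S'))\<^sup>2)
      - ((\<Sum>i\<in>UNIV. (norm (a i))\<^sup>2) - (\<Sum>i\<in>UNIV. (norm (a' i))\<^sup>2) - (\<Sum>i\<in>UNIV. (norm (a i - a' i))\<^sup>2))"
      unfolding in2 by (simp add: sum_subtractf)
    finally have *: "S' \<bullet> (S - S') - (\<Sum>i\<in>UNIV. a' i \<bullet> (a i - a' i)) = \<dots> / 2" by simp
    show ?thesis
      unfolding * coupling_def
      by (simp add: diff S_def S'_def sum_subtractf flip: a_def a'_def) (simp add: algebra_simps)
  qed
  also have "sum ?prox UNIV = ((1 + \<mu>) * weight (x k - xs) - (1 + \<mu>) * weight (x (Suc k) - xs)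
      - (1 - \<mu>) * weight (x k - x (Suc k))) / 2"
  proof -
    have "?prox i = ((1 + \<mu>) * (r i * (norm ((x k - xs) $ i))\<^sup>2) - (1 + \<mu>) * (r i * (norm ((x (Suc k) - xs) $ i))\<^sup>2)
      - (1 - \<mu>) * (r i * (norm ((x k - x (Suc k)) $ i))\<^sup>2)) / 2" for i
      unfolding power2_norm_eq_inner
      by (simp add: inner_simps inner_commute field_simps)
    then show ?thesis
      unfolding weight_def sum_distrib_left sum_subtractf[symmetric] sum_divide_distrib
      by (intro sum.cong refl)
  qed
  also have "S' = res (Suc k) - B *v (y (Suc k) - ys)"
    by (simp add: res_eq S'_def a'_def)
  finally show ?thesis
    by (simp add: block_potential_def block_gap_def field_simps)
qed

text \<open>Adds the x-descent, the y-condition at \<open>ys\<close> and the saddle inequality at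
  the new iterate; all values of \<open>f\<close> and \<open>g\<close> cancel. What remains beyond
  the telescoping terms involves only the new residual and the y-step image.\<close>

lemma potential_step:
  defines "\<delta> k \<equiv> B *v (y (Suc k) - y k)"
  shows "potential (Suc k) + block_gap (x k - x (Suc k)) \<le> potential k
    + \<beta> * ((1 - \<alpha>) * (res (Suc k) \<bullet> \<delta> k) - (1 - \<alpha>) / 2 * (norm (\<delta> k))\<^sup>2
      - (1 - (\<alpha> + \<tau>) / 2) * (norm (res (Suc k)))\<^sup>2)"
proof -
  define R q d where "R = res (Suc k)" and "q = B *v (y (Suc k) - ys)" and "d = \<delta> k"
  have q: "B *v (y k - ys) = q - d"
    by (simp add: q_def d_def \<delta>_def matrix_vector_mult_diff_distrib)
  have h: "half_res k = R - d" by (simp add: R_def d_def \<delta>_def res_Suc)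
  \<comment> \<open>Reciprocal of the weight of \<eta> in \<open>potential\<close>, chosen so that
    the cross term in the weighted square is exactly the inner product of \<eta> with
    \<open>R\<close>.\<close>
  define c where "c = 2 * (\<alpha> + \<tau>) * \<beta>"
  have c: "c > 0" using step_size_bounds \<beta>_pos by (simp add: c_def)
  have "(norm (\<eta> (Suc k)))\<^sup>2 = (norm (\<eta> k))\<^sup>2 + c * ((\<alpha> + \<tau>) * \<beta> / 2 * (R \<bullet> R) - \<eta> k \<bullet> R)"
    unfolding \<eta>_Suc power2_norm_eq_inner R_def[symmetric] c_def
    by (simp add: inner_simps inner_commute power2_eq_square algebra_simps)
  then have \<eta>': "1 / c * (norm (\<eta> (Suc k)))\<^sup>2
    = 1 / c * (norm (\<eta> k))\<^sup>2 + ((\<alpha> + \<tau>) * \<beta> / 2 * (R \<bullet> R) - \<eta> k \<bullet> R)"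
    using c by (simp add: distrib_left)
  have \<eta>: "\<eta> k = l k - ls - (\<alpha> * \<beta>) *\<^sub>R (q - d)" by (simp add: \<eta>_def q)
  have x: "0 \<le> (\<Sum>i\<in>UNIV. f i (xs $ i)) - (\<Sum>i\<in>UNIV. f i (x (Suc k) $ i))
    - (R - q) \<bullet> (\<beta> *\<^sub>R (R - d) - l k)
    + block_potential (x k - xs) - block_potential (x (Suc k) - xs) - block_gap (x k - x (Suc k))"
    using x_step_descent[of k] by (simp add: R_def q_def h)
  have y: "0 \<le> g ys - g (y (Suc k)) - q \<bullet> (\<beta> *\<^sub>R R - (l k - (\<alpha> * \<beta>) *\<^sub>R (R - d)))"
  proof -
    have "B *v (ys - y (Suc k)) = - q" by (simp add: q_def matrix_vector_mult_diff_distrib)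
    then show ?thesis
      using y_variational_inequality[OF W_starD(2)[OF saddle], of k]
      by (simp add: half_l_def h R_def)
  qed
  have xy: "0 \<le> (\<Sum>i\<in>UNIV. f i (x (Suc k) $ i)) + g (y (Suc k)) - (\<Sum>i\<in>UNIV. f i (xs $ i)) - g ys - ls \<bullet> R"
    using W_starD(4)[OF saddle, of "x (Suc k)" "y (Suc k)"] x_nonneg y_in_Y
    by (simp add: X_set_def objective_def R_def res_def)
  \<comment> \<open>Pure algebra: the multiplier terms reproduce the change of the \<eta>-square and
    the y-errors telescope.\<close>
  have "- ((R - q) \<bullet> (\<beta> *\<^sub>R (R - d) - l k)) - q \<bullet> (\<beta> *\<^sub>R R - (l k - (\<alpha> * \<beta>) *\<^sub>R (R - d))) - ls \<bullet> R
    = (\<eta> k \<bullet> R - (\<alpha> + \<tau>) * \<beta> / 2 * (R \<bullet> R))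
      + ((1 - \<alpha>) * \<beta> / 2 * (norm (q - d))\<^sup>2 - (1 - \<alpha>) * \<beta> / 2 * (norm q)\<^sup>2)
      + \<beta> * ((1 - \<alpha>) * (R \<bullet> d) - (1 - \<alpha>) / 2 * (norm d)\<^sup>2 - (1 - (\<alpha> + \<tau>) / 2) * (norm R)\<^sup>2)"
    unfolding \<eta> power2_norm_eq_inner
    by (simp add: inner_simps inner_commute field_simps)
  then show ?thesis
    unfolding potential_def q q_def[symmetric] d_def[symmetric] R_def[symmetric] c_def[symmetric]
    using \<eta>' x y xy by linarith
qed

text \<open>The weight of the residual is the constant produced by \<open>relaxation_bound\<close>,
  so the old residual pays for the bad inner product of the next step.\<close>

definition lyapunov :: "nat \<Rightarrow> real" where
  "lyapunov k = potential k + \<beta> * ((1 - \<tau>)\<^sup>2 / (2 * (1 + \<alpha>))) * (norm (res k))\<^sup>2"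

lemma lyapunov_step:
  "lyapunov (Suc (Suc k)) \<le> lyapunov (Suc k) - (block_gap (x (Suc k) - x (Suc (Suc k)))
    + \<beta> * ((1 + \<alpha> + \<tau> - \<alpha> * \<tau> - \<alpha>\<^sup>2 - \<tau>\<^sup>2) / (2 * (1 + \<alpha>))) * (norm (res (Suc (Suc k))))\<^sup>2)"
proof -
  define R R' d where "R = res (Suc k)" and "R' = res (Suc (Suc k))"
    and "d = B *v (y (Suc (Suc k)) - y (Suc k))"
  define K K' where "K = (1 - \<tau>)\<^sup>2 / (2 * (1 + \<alpha>))"
    and "K' = (1 + \<alpha> + \<tau> - \<alpha> * \<tau> - \<alpha>\<^sup>2 - \<tau>\<^sup>2) / (2 * (1 + \<alpha>))"
  have "(1 - \<alpha>) * (R' \<bullet> d) - (1 - \<alpha>) / 2 * (norm d)\<^sup>2 \<le> K * (norm R)\<^sup>2"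
    unfolding K_def
  proof (rule relaxation_bound)
    show "(1 + \<alpha>) * (R' \<bullet> d) \<le> (1 - \<tau>) * (R \<bullet> d) + \<alpha> * (norm d)\<^sup>2"
      using y_step_monotone[of k] by (simp add: R_def R'_def d_def)
    \<comment> \<open>This combination is chosen so that expanding its square gives the sign
      condition of \<open>relaxation_bound\<close>.\<close>
    have "0 \<le> (norm ((1 - \<tau>) *\<^sub>R R - (1 - \<alpha>) *\<^sub>R d))\<^sup>2" by simp
    also have "\<dots> = (1 - \<tau>)\<^sup>2 * (norm R)\<^sup>2 - 2 * (1 - \<tau>) * (1 - \<alpha>) * (R \<bullet> d) + (1 - \<alpha>)\<^sup>2 * (norm d)\<^sup>2"
      unfolding power2_norm_eq_inner
      by (simp add: inner_simps inner_commute power2_eq_square algebra_simps)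
    finally show "0 \<le> \<dots>" .
  qed (use step_size_bounds in auto)
  \<comment> \<open>The available residual coefficient splits into the stored part \<open>K\<close>
    and the net decrease \<open>K'\<close>, positive by the last inequality of
    \<open>step_region\<close>.\<close>
  moreover have "1 - (\<alpha> + \<tau>) / 2 = K + K'"
  proof -
    have "(1 - \<tau>)\<^sup>2 + (1 + \<alpha> + \<tau> - \<alpha> * \<tau> - \<alpha>\<^sup>2 - \<tau>\<^sup>2) = (2 - \<alpha> - \<tau>) * (1 + \<alpha>)"
      by (simp add: power2_eq_square algebra_simps)
    then have "K + K' = (2 - \<alpha> - \<tau>) * (1 + \<alpha>) / (2 * (1 + \<alpha>))"
      by (simp add: K_def K'_def flip: add_divide_distrib)
    also have "\<dots> = (2 - \<alpha> - \<tau>) / 2"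
      by (intro mult_divide_mult_cancel_right) (use step_size_bounds(1) in auto)
    finally show ?thesis by (simp add: field_simps)
  qed
  ultimately have "\<beta> * ((1 - \<alpha>) * (R' \<bullet> d) - (1 - \<alpha>) / 2 * (norm d)\<^sup>2 - (1 - (\<alpha> + \<tau>) / 2) * (norm R')\<^sup>2)
    \<le> \<beta> * (K * (norm R)\<^sup>2 - (K + K') * (norm R')\<^sup>2)"
    using \<beta>_pos by (intro mult_left_mono) auto
  also have "\<dots> = \<beta> * K * (norm R)\<^sup>2 - \<beta> * K * (norm R')\<^sup>2 - \<beta> * K' * (norm R')\<^sup>2"
    by (simp add: algebra_simps)
  finally show ?thesis
    using potential_step[of "Suc k"]
    unfolding lyapunov_def R_def[symmetric] R'_def[symmetric] d_def[symmetric] K_def[symmetric] K'_def[symmetric]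
    by linarith
qed

subsection \<open>Convergence\<close>

lemma lyapunov_ge:
  obtains c where "0 < c"
    "\<And>k. c * ((norm (x k - xs))\<^sup>2 + (norm (\<eta> k))\<^sup>2 + (norm (B *v (y k - ys)))\<^sup>2) \<le> lyapunov k"
proof -
  obtain c\<^sub>1 where c\<^sub>1: "0 < c\<^sub>1" "\<And>u. c\<^sub>1 * (norm u)\<^sup>2 \<le> block_gap u"
    by (rule block_gap_coercive) blast
  define c\<^sub>2 c\<^sub>3 c where "c\<^sub>2 = 1 / (2 * (\<alpha> + \<tau>) * \<beta>)" and "c\<^sub>3 = (1 - \<alpha>) * \<beta> / 2"
    and "c = min c\<^sub>1 (min c\<^sub>2 c\<^sub>3)"
  have pos: "0 < c\<^sub>2" "0 < c\<^sub>3" using step_size_bounds \<beta>_pos by (auto simp: c\<^sub>2_def c\<^sub>3_def)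
  have "c * ((norm (x k - xs))\<^sup>2 + (norm (\<eta> k))\<^sup>2 + (norm (B *v (y k - ys)))\<^sup>2) \<le> lyapunov k" for k
  proof -
    have "c * (norm (x k - xs))\<^sup>2 \<le> c\<^sub>1 * (norm (x k - xs))\<^sup>2"
      by (intro mult_right_mono) (auto simp: c_def)
    also have "\<dots> \<le> block_potential (x k - xs)"
      using c\<^sub>1(2) block_gap_le_potential by (rule order_trans)
    finally have "c * (norm (x k - xs))\<^sup>2 \<le> block_potential (x k - xs)" .
    moreover have "c * (norm (\<eta> k))\<^sup>2 \<le> c\<^sub>2 * (norm (\<eta> k))\<^sup>2"
      by (intro mult_right_mono) (auto simp: c_def)
    moreover have "c * (norm (B *v (y k - ys)))\<^sup>2 \<le> c\<^sub>3 * (norm (B *v (y k - ys)))\<^sup>2"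
      by (intro mult_right_mono) (auto simp: c_def)
    moreover have "0 \<le> \<beta> * ((1 - \<tau>)\<^sup>2 / (2 * (1 + \<alpha>))) * (norm (res k))\<^sup>2"
      using step_size_bounds \<beta>_pos by simp
    ultimately show ?thesis
      unfolding lyapunov_def potential_def c\<^sub>2_def[symmetric] c\<^sub>3_def[symmetric] distrib_left[of c] by linarith
  qed
  then show thesis using that[of c] c\<^sub>1(1) pos by (simp add: c_def)
qed

lemma lyapunov_nonneg: "0 \<le> lyapunov k"
proof -
  obtain c where c: "0 < c"
    "\<And>k. c * ((norm (x k - xs))\<^sup>2 + (norm (\<eta> k))\<^sup>2 + (norm (B *v (y k - ys)))\<^sup>2) \<le> lyapunov k"
    by (rule lyapunov_ge) blast
  have "0 \<le> c * ((norm (x k - xs))\<^sup>2 + (norm (\<eta> k))\<^sup>2 + (norm (B *v (y k - ys)))\<^sup>2)"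
    using c(1) by simp
  also have "\<dots> \<le> lyapunov k" by (rule c(2))
  finally show ?thesis .
qed

text \<open>The Lyapunov function sees the multiplier only through \<eta> and y only through
  \<open>B\<close>: adding back the shift recovers \<open>l k - ls\<close>, and injectivity of
  \<open>B\<close> recovers \<open>y k - ys\<close>.\<close>

lemma distance_le_lyapunov:
  obtains C where "\<And>k. (norm ((x k, y k, l k) - (xs, ys, ls)))\<^sup>2 \<le> C * lyapunov k"
proof -
  obtain c where c: "0 < c"
    "\<And>k. c * ((norm (x k - xs))\<^sup>2 + (norm (\<eta> k))\<^sup>2 + (norm (B *v (y k - ys)))\<^sup>2) \<le> lyapunov k"
    by (rule lyapunov_ge) blast
  obtain e where e: "0 < e" "\<And>v. e * norm v \<le> norm (B *v v)"
    by (rule B_bounded_below) blast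
  \<comment> \<open>Dominates the coefficients 1, 2 and
    \<open>1 / e\<^sup>2 + 2 * (\<alpha> * \<beta>)\<^sup>2\<close> of the three squares
    below.\<close>
  define K where "K = 2 + 1 / e\<^sup>2 + 2 * (\<alpha> * \<beta>)\<^sup>2"
  have "(norm ((x k, y k, l k) - (xs, ys, ls)))\<^sup>2 \<le> K / c * lyapunov k" for k
  proof -
    define q where "q = B *v (y k - ys)"
    let ?X = "(norm (x k - xs))\<^sup>2" and ?E = "(norm (\<eta> k))\<^sup>2" and ?Q = "(norm q)\<^sup>2"
    have "(e * norm (y k - ys))\<^sup>2 \<le> ?Q"
      unfolding q_def using e by (intro power_mono) auto
    then have y: "(norm (y k - ys))\<^sup>2 \<le> 1 / e\<^sup>2 * ?Q"
      using e(1) by (simp add: field_simps power_mult_distrib)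
    have l_eq: "l k - ls = \<eta> k + (\<alpha> * \<beta>) *\<^sub>R q" by (simp add: \<eta>_def q_def)
    have sum_le: "(norm (p + p'))\<^sup>2 \<le> 2 * (norm p)\<^sup>2 + 2 * (norm p')\<^sup>2" for p p' :: "real^'n"
      using zero_le_power2[of "norm (p - p')"] unfolding power2_norm_eq_inner
      by (simp add: inner_simps inner_commute)
    have "(norm (l k - ls))\<^sup>2 \<le> 2 * ?E + 2 * (norm ((\<alpha> * \<beta>) *\<^sub>R q))\<^sup>2"
      unfolding l_eq by (rule sum_le)
    then have l: "(norm (l k - ls))\<^sup>2 \<le> 2 * ?E + 2 * (\<alpha> * \<beta>)\<^sup>2 * ?Q"
      by (simp add: power_mult_distrib)
    have "(norm ((x k, y k, l k) - (xs, ys, ls)))\<^sup>2 = ?X + ((norm (y k - ys))\<^sup>2 + (norm (l k - ls))\<^sup>2)"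
      by (simp add: norm_Pair)
    also have "\<dots> \<le> ?X + (1 / e\<^sup>2 * ?Q + (2 * ?E + 2 * (\<alpha> * \<beta>)\<^sup>2 * ?Q))"
      using y l by linarith
    also have "\<dots> \<le> K * (?X + ?E + ?Q)"
    proof -
      have "K * (?X + ?E + ?Q) - (?X + (1 / e\<^sup>2 * ?Q + (2 * ?E + 2 * (\<alpha> * \<beta>)\<^sup>2 * ?Q)))
        = ?X + 2 * ?Q + (1 / e\<^sup>2 + 2 * (\<alpha> * \<beta>)\<^sup>2) * (?X + ?E)"
        by (simp add: K_def algebra_simps)
      also have "\<dots> \<ge> 0" by (intro add_nonneg_nonneg mult_nonneg_nonneg) auto
      finally show ?thesis by simp
    qed
    also have "\<dots> = K / c * (c * (?X + ?E + ?Q))" using c(1) by simp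
    also have "\<dots> \<le> K / c * lyapunov k"
      unfolding q_def using c by (intro mult_left_mono c(2)) (auto simp: K_def)
    finally show ?thesis .
  qed
  then show thesis by (rule that)
qed

lemma descent_tendsto_0:
  shows "(\<lambda>k. x k - x (Suc k)) \<longlonglongrightarrow> 0" and "res \<longlonglongrightarrow> 0"
proof -
  define K where "K = \<beta> * ((1 + \<alpha> + \<tau> - \<alpha> * \<tau> - \<alpha>\<^sup>2 - \<tau>\<^sup>2) / (2 * (1 + \<alpha>)))"
  have K: "0 < K" using step_size_bounds \<beta>_pos by (simp add: K_def)
  obtain c where c: "0 < c" "\<And>u. c * (norm u)\<^sup>2 \<le> block_gap u"
    by (rule block_gap_coercive) blast
  \<comment> \<open>Descent is available only from index 1 on, hence the shifts, which are undone at
    the end.\<close>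
  let ?d = "\<lambda>k. c * (norm (x (Suc k) - x (Suc (Suc k))))\<^sup>2 + K * (norm (res (Suc (Suc k))))\<^sup>2"
  have d: "?d \<longlonglongrightarrow> 0"
  proof (rule descent_imp_tendsto_0)
    show "0 \<le> lyapunov (Suc k)" for k by (rule lyapunov_nonneg)
    show "0 \<le> ?d k" for k using c K by simp
    show "lyapunov (Suc (Suc k)) \<le> lyapunov (Suc k) - ?d k" for k
      using lyapunov_step[of k] c(2)[of "x (Suc k) - x (Suc (Suc k))"] unfolding K_def[symmetric] by linarith
  qed
  have square: "v \<longlonglongrightarrow> 0" if "0 < a" "\<And>k. a * (norm (v k))\<^sup>2 \<le> ?d k"
    for a and v :: "nat \<Rightarrow> 'z::real_normed_vector"
  proof -
    have "(\<lambda>k. a * (norm (v k))\<^sup>2) \<longlonglongrightarrow> 0"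
      by (rule real_tendsto_sandwich[OF _ _ tendsto_const d]) (use that in auto)
    from tendsto_mult_left[OF this, of "1 / a"] have "(\<lambda>k. (norm (v k))\<^sup>2) \<longlonglongrightarrow> 0"
      using \<open>0 < a\<close> by simp
    from tendsto_real_sqrt[OF this] show ?thesis
      by (simp add: tendsto_norm_zero_iff)
  qed
  have "(\<lambda>k. x (Suc k) - x (Suc (Suc k))) \<longlonglongrightarrow> 0"
    by (rule square[OF c(1)]) (use K in simp)
  then show "(\<lambda>k. x k - x (Suc k)) \<longlonglongrightarrow> 0"
    by (rule LIMSEQ_imp_Suc)
  have "(\<lambda>k. res (Suc (Suc k))) \<longlonglongrightarrow> 0"
    by (rule square[OF K]) (use c in simp)
  then show "res \<longlonglongrightarrow> 0"
    by (rule LIMSEQ_imp_Suc[OF LIMSEQ_imp_Suc])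
qed

lemma lyapunov_convergent:
  obtains L where "lyapunov \<longlonglongrightarrow> L"
proof -
  have decseq: "decseq (\<lambda>k. lyapunov (Suc k))"
  proof (rule decseq_SucI)
    fix k
    have "0 \<le> block_gap (x (Suc k) - x (Suc (Suc k)))" by (rule block_gap_nonneg)
    moreover have "0 \<le> \<beta> * ((1 + \<alpha> + \<tau> - \<alpha> * \<tau> - \<alpha>\<^sup>2 - \<tau>\<^sup>2) / (2 * (1 + \<alpha>))) * (norm (res (Suc (Suc k))))\<^sup>2"
      using step_size_bounds \<beta>_pos by simp
    ultimately show "lyapunov (Suc (Suc k)) \<le> lyapunov (Suc k)"
      using lyapunov_step[of k] by linarith
  qed
  obtain L where "(\<lambda>k. lyapunov (Suc k)) \<longlonglongrightarrow> L"
    by (rule decseq_convergent[OF decseq, of 0]) (use lyapunov_nonneg in blast)+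
  then have "lyapunov \<longlonglongrightarrow> L" by (rule LIMSEQ_imp_Suc)
  then show thesis by (rule that)
qed

text \<open>The descent estimate keeps no y-step term; the image of the y-step is recovered from
  consecutive residuals and the vanishing x-step.\<close>

lemma y_diff_tendsto_0: "(\<lambda>k. y (Suc k) - y k) \<longlonglongrightarrow> 0"
proof -
  obtain e where e: "0 < e" "\<And>v. e * norm v \<le> norm (B *v v)"
    by (rule B_bounded_below) blast
  have "B *v (y (Suc k) - y k) = res (Suc k) - res k + (\<Sum>i\<in>UNIV. A i *v ((x k - x (Suc k)) $ i))" for k
    by (simp add: res_def residual_def matrix_vector_mult_diff_distrib sum_subtractf)
  moreover have "(\<lambda>k. res (Suc k) - res k + (\<Sum>i\<in>UNIV. A i *v ((x k - x (Suc k)) $ i)))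
    \<longlonglongrightarrow> 0 - 0 + (\<Sum>i\<in>UNIV. A i *v (0 $ i))"
    by (intro tendsto_intros tendsto_matrix_vector LIMSEQ_Suc descent_tendsto_0)
  ultimately have lim: "(\<lambda>k. norm (B *v (y (Suc k) - y k)) / e) \<longlonglongrightarrow> 0"
    by (auto intro: tendsto_divide_zero tendsto_norm_zero)
  have "(\<lambda>k. norm (y (Suc k) - y k)) \<longlonglongrightarrow> 0"
    by (rule real_tendsto_sandwich[OF _ _ tendsto_const lim])
      (use e in \<open>auto simp: field_simps\<close>)
  then show ?thesis by (simp add: tendsto_norm_zero_iff)
qed

text \<open>Consecutive differences vanish, so iterates at \<open>s n\<close> and
  \<open>Suc (s n)\<close> share their limits and the optimality conditions pass to the limit. No
  Lipschitz or continuity assumption on \<open>f\<close> enters: closed epigraphs suffice.\<close>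

lemma subsequence_limit_in_W_star:
  assumes s: "strict_mono s" and lim: "(\<lambda>n. (x (s n), y (s n), l (s n))) \<longlonglongrightarrow> (xa, ya, la)"
  shows "(xa, ya, la) \<in> W_star I A B b f g Y"
proof -
  have sub: "(\<lambda>n. u (s n)) \<longlonglongrightarrow> u'" if "u \<longlonglongrightarrow> u'" for u and u' :: "'z::topological_space"
    using LIMSEQ_subseq_LIMSEQ[OF that s] by (simp add: o_def)
  have xa: "(\<lambda>n. x (s n)) \<longlonglongrightarrow> xa" and ya: "(\<lambda>n. y (s n)) \<longlonglongrightarrow> ya" and la: "(\<lambda>n. l (s n)) \<longlonglongrightarrow> la"
    using tendsto_fst[OF lim] tendsto_fst[OF tendsto_snd[OF lim]] tendsto_snd[OF tendsto_snd[OF lim]] by simp_all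
  have dx: "(\<lambda>n. x (s n) - x (Suc (s n))) \<longlonglongrightarrow> 0"
    by (rule sub[OF descent_tendsto_0(1)])
  have xa': "(\<lambda>n. x (Suc (s n))) \<longlonglongrightarrow> xa"
    using tendsto_diff[OF xa dx] by simp
  have dy: "(\<lambda>n. y (Suc (s n)) - y (s n)) \<longlonglongrightarrow> 0"
    by (rule sub[OF y_diff_tendsto_0])
  have ya': "(\<lambda>n. y (Suc (s n))) \<longlonglongrightarrow> ya"
    using tendsto_add[OF ya dy] by simp
  have res': "(\<lambda>n. res (Suc (s n))) \<longlonglongrightarrow> 0"
    by (rule sub[OF LIMSEQ_Suc[OF descent_tendsto_0(2)]])
  have half: "(\<lambda>n. half_res (s n)) \<longlonglongrightarrow> 0"
    using tendsto_diff[OF res' tendsto_matrix_vector[OF dy, of B]] by (simp add: res_Suc)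
  have half_l: "(\<lambda>n. half_l (s n)) \<longlonglongrightarrow> la"
    unfolding half_l_def by (rule tendsto_eq_intros la half refl | simp)+
  have ya_in: "ya \<in> Y"
    using closed_sequentially[OF closed_Y _ ya'] y_in_Y by blast
  have res: "residual A B b xa ya = 0"
  proof (rule LIMSEQ_unique)
    show "(\<lambda>n. res (s n)) \<longlonglongrightarrow> residual A B b xa ya"
      unfolding res_def residual_def by (intro tendsto_intros tendsto_matrix_vector xa ya)
    show "(\<lambda>n. res (s n)) \<longlonglongrightarrow> 0" by (rule sub[OF descent_tendsto_0(2)])
  qed
  have f: "xa $ i \<in> nonneg_orthant (I i) \<and> f i (xa $ i) \<le> f i u - (A i *v (u - xa $ i)) \<bullet> la"
    if u: "u \<in> nonneg_orthant (I i)" for i u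
  proof (rule closed_epigraph_limit)
    \<comment> \<open>Written in terms of the x-step so that the cross-block and proximal terms
      visibly tend to zero.\<close>
    let ?c = "\<lambda>n. f i u
      + (A i *v (u - x (Suc (s n)) $ i)) \<bullet>
        (\<beta> *\<^sub>R (half_res (s n) + (\<Sum>j\<in>UNIV - {i}. A j *v (x (s n) - x (Suc (s n))) $ j)) - l (s n))
      + r i * ((u - x (Suc (s n)) $ i) \<bullet> - ((x (s n) - x (Suc (s n))) $ i)
        + \<mu> * (- ((x (s n) - x (Suc (s n))) $ i) \<bullet> (u - x (s n) $ i)))"
    show "closed (epigraph (nonneg_orthant (I i)) (f i))"
      using f_closed_convex by (simp add: closed_proper_convex_on_def)
    show "x (Suc (s n)) $ i \<in> nonneg_orthant (I i)" for n by (rule x_nonneg)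
    show "f i (x (Suc (s n)) $ i) \<le> ?c n" for n
      using x_variational_inequality[OF u, of "s n"] by (simp del: matrix_vector_mult_diff_distrib)
    show "(\<lambda>n. x (Suc (s n)) $ i) \<longlonglongrightarrow> xa $ i" by (intro tendsto_vec_nth xa')
    have "?c \<longlonglongrightarrow> f i u + (A i *v (u - xa $ i)) \<bullet>
        (\<beta> *\<^sub>R (0 + (\<Sum>j\<in>UNIV - {i}. A j *v 0 $ j)) - la)
      + r i * ((u - xa $ i) \<bullet> - (0 $ i) + \<mu> * (- (0 $ i) \<bullet> (u - xa $ i)))"
      by (intro tendsto_intros tendsto_matrix_vector xa xa' dx half la)
    then show "?c \<longlonglongrightarrow> f i u - (A i *v (u - xa $ i)) \<bullet> la"
      by simp
  qed
  have g: "g ya \<le> g v - (B *v (v - ya)) \<bullet> la" if v: "v \<in> Y" for v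
  proof -
    let ?c = "\<lambda>n. g v + (B *v (v - y (Suc (s n)))) \<bullet> (\<beta> *\<^sub>R res (Suc (s n)) - half_l (s n))"
    have "?c \<longlonglongrightarrow> g v + (B *v (v - ya)) \<bullet> (\<beta> *\<^sub>R 0 - la)"
      by (intro tendsto_intros tendsto_matrix_vector ya' res' half_l)
    then have c: "?c \<longlonglongrightarrow> g v - (B *v (v - ya)) \<bullet> la" by simp
    have "g (y (Suc (s n))) \<le> ?c n" for n
      using y_variational_inequality[OF v, of "s n"] by linarith
    then show ?thesis
      using closed_epigraph_limit[of UNIV g, OF _ _ _ ya' c] g_closed_convex
      by (simp add: closed_proper_convex_on_def)
  qed
  show ?thesis
  proof (rule W_starI[OF _ ya_in res])
    \<comment> \<open>The limit fact \<open>f\<close> requires some test point in the orthant; any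
      iterate serves.\<close>
    show "xa \<in> X_set I" using f x_nonneg unfolding X_set_def by blast
    show "0 \<le> f i u - f i (xa $ i) - (A i *v (u - xa $ i)) \<bullet> la" if "u \<in> nonneg_orthant (I i)" for i u
      using f[OF that] by linarith
    show "0 \<le> g v - g ya - (B *v (v - ya)) \<bullet> la" if "v \<in> Y" for v
      using g[OF that] by linarith
  qed
qed

lemma convergent_subsequence:
  obtains s w where "strict_mono s" "(\<lambda>n. (x (s n), y (s n), l (s n))) \<longlonglongrightarrow> w"
proof -
  obtain C where C: "\<And>k. (norm ((x k, y k, l k) - (xs, ys, ls)))\<^sup>2 \<le> C * lyapunov k"
    by (rule distance_le_lyapunov) blast
  obtain L where "lyapunov \<longlonglongrightarrow> L" by (rule lyapunov_convergent)
  then have "(\<lambda>k. C * lyapunov k) \<longlonglongrightarrow> C * L" by (rule tendsto_mult_left)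
  then have "Bseq (\<lambda>k. C * lyapunov k)" by (intro convergent_imp_Bseq) (rule convergentI)
  then obtain K where K: "\<And>k. norm (C * lyapunov k) \<le> K" by (elim BseqE) blast
  have "norm (x k, y k, l k) \<le> norm (xs, ys, ls) + sqrt K" for k
  proof -
    have "(norm ((x k, y k, l k) - (xs, ys, ls)))\<^sup>2 \<le> K"
      using C[of k] K[of k] by (simp del: diff_Pair)
    then have "norm ((x k, y k, l k) - (xs, ys, ls)) \<le> sqrt K" by (rule real_le_rsqrt)
    with norm_triangle_sub[of "(x k, y k, l k)" "(xs, ys, ls)"] show ?thesis by linarith
  qed
  then have "bounded (range (\<lambda>k. (x k, y k, l k)))" by (intro boundedI) blast
  from bounded_imp_convergent_subsequence[OF this]
  obtain w s where "strict_mono s" "((\<lambda>k. (x k, y k, l k)) \<circ> s) \<longlonglongrightarrow> w"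
    by (elim exE conjE)
  then show thesis by (intro that[of s w]) (simp_all add: o_def)
qed

text \<open>The Lyapunov function converges along the full sequence, and by continuity its limit
  along the subsequence is 0. So the full limit is 0, and it controls the distance to the
  centre.\<close>

lemma tendsto_saddle:
  assumes s: "strict_mono s" and lim: "(\<lambda>n. (x (s n), y (s n), l (s n))) \<longlonglongrightarrow> (xs, ys, ls)"
  shows "(\<lambda>k. (x k, y k, l k)) \<longlonglongrightarrow> (xs, ys, ls)"
proof -
  have xa: "(\<lambda>n. x (s n)) \<longlonglongrightarrow> xs" and ya: "(\<lambda>n. y (s n)) \<longlonglongrightarrow> ys" and la: "(\<lambda>n. l (s n)) \<longlonglongrightarrow> ls"
    using tendsto_fst[OF lim] tendsto_fst[OF tendsto_snd[OF lim]] tendsto_snd[OF tendsto_snd[OF lim]] by simp_all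
  have res: "(\<lambda>n. res (s n)) \<longlonglongrightarrow> 0"
    using LIMSEQ_subseq_LIMSEQ[OF descent_tendsto_0(2) s] by (simp add: o_def)
  obtain L where L: "lyapunov \<longlonglongrightarrow> L" by (rule lyapunov_convergent)
  have "(\<lambda>n. lyapunov (s n)) \<longlonglongrightarrow>
    ((1 + \<mu>) * (\<Sum>i\<in>UNIV. r i * (norm ((xs - xs) $ i))\<^sup>2)
      + \<beta> * ((\<Sum>i\<in>UNIV. (norm (A i *v (xs - xs) $ i))\<^sup>2) - (norm (\<Sum>i\<in>UNIV. A i *v (xs - xs) $ i))\<^sup>2)) / 2
    + 1 / (2 * (\<alpha> + \<tau>) * \<beta>) * (norm (ls - ls - (\<alpha> * \<beta>) *\<^sub>R (B *v (ys - ys))))\<^sup>2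
    + (1 - \<alpha>) * \<beta> / 2 * (norm (B *v (ys - ys)))\<^sup>2
    + \<beta> * ((1 - \<tau>)\<^sup>2 / (2 * (1 + \<alpha>))) * (norm (0 :: real^'n))\<^sup>2"
    unfolding lyapunov_def potential_def block_potential_def weight_def coupling_def \<eta>_def
    by (intro tendsto_intros tendsto_matrix_vector xa ya la res) simp_all
  then have "(\<lambda>n. lyapunov (s n)) \<longlonglongrightarrow> 0" by simp
  with LIMSEQ_subseq_LIMSEQ[OF L s] have "L = 0"
    unfolding o_def by (rule LIMSEQ_unique)
  obtain C where C: "\<And>k. (norm ((x k, y k, l k) - (xs, ys, ls)))\<^sup>2 \<le> C * lyapunov k"
    by (rule distance_le_lyapunov) blast
  have lim0: "(\<lambda>k. C * lyapunov k) \<longlonglongrightarrow> 0"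
    using tendsto_mult_left[OF L, of C] \<open>L = 0\<close> by simp
  have "(\<lambda>k. (norm ((x k, y k, l k) - (xs, ys, ls)))\<^sup>2) \<longlonglongrightarrow> 0"
    by (rule real_tendsto_sandwich[OF _ _ tendsto_const lim0]) (use C in \<open>auto simp del: diff_Pair\<close>)
  from tendsto_real_sqrt[OF this] have "(\<lambda>k. (x k, y k, l k) - (xs, ys, ls)) \<longlonglongrightarrow> 0"
    by (simp add: tendsto_norm_zero_iff del: diff_Pair)
  then show ?thesis by (rule LIM_zero_cancel)
qed

end

section \<open>Assembly of the convergence statements\<close>

theorem theorem4:
  fixes I :: "'p::finite \<Rightarrow> 'm::finite set"
    and A :: "'p \<Rightarrow> real^'m^'n::finite"
    and B :: "real^'d::finite^'n"
    and b :: "real^'n"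
    and f :: "'p \<Rightarrow> real^'m \<Rightarrow> real"
    and g :: "real^'d \<Rightarrow> real"
    and Y :: "(real^'d) set"
    and \<beta> \<mu> \<alpha> \<tau> \<gamma> :: real
    and r :: "'p \<Rightarrow> real"
    and x :: "nat \<Rightarrow> (real^'m)^'p"
    and y :: "nat \<Rightarrow> real^'d"
    and l :: "nat \<Rightarrow> real^'n"
  assumes "\<And>i. I i \<noteq> {}"
    and "\<And>i. columns_supported (I i) (A i)"
    and "\<And>i. rank (A i) = card (I i)"
    and "rank B = CARD('d)"
    and "\<And>i. closed_proper_convex_on (nonneg_orthant (I i)) (f i)"
    and "closed_proper_convex_on UNIV g"
    and "closed Y" and "convex Y"
    and "problem_solutions I A B b f g Y \<noteq> {}"
    and "W_star I A B b f g Y \<noteq> {}"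
    and "\<beta> > 0" and "0 < \<mu>" and "\<mu> < 1"
    and "(\<alpha>, \<tau>) \<in> step_region"
    and "\<And>i. r i > 0"
    and "\<gamma> > (real CARD('p) - 1) / (1 - \<mu>)"
    and "\<And>i. r i \<ge> \<gamma> * \<beta> * onorm ((*v) (transpose (A i) ** A i))"
    and "admm_lqp I A B b f g Y \<beta> \<mu> r \<alpha> \<tau> x y l"
  shows "((\<lambda>k. \<Sum>i\<in>UNIV. (norm (A i *v (x k $ i - x (Suc k) $ i)))\<^sup>2) \<longlonglongrightarrow> 0 \<and>
          (\<lambda>k. (norm (residual A B b (x (Suc k)) (y (Suc k))))\<^sup>2) \<longlonglongrightarrow> 0) \<and>
         (\<forall>w. accumulation_point (\<lambda>k. (x k, y k, l k)) w \<longrightarrow> w \<in> W_star I A B b f g Y) \<and>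
         (\<exists>w\<in>W_star I A B b f g Y. (\<lambda>k. (x k, y k, l k)) \<longlonglongrightarrow> w)"
proof -
  interpret admm_lqp_iteration I A B b f g Y \<beta> \<mu> \<alpha> \<tau> \<gamma> r x y l
    by unfold_locales (use assms in auto)
  obtain xs ys ls where "(xs, ys, ls) \<in> W_star I A B b f g Y"
    using assms(10) by auto
  then interpret admm_lqp_saddle I A B b f g Y \<beta> \<mu> \<alpha> \<tau> \<gamma> r x y l xs ys ls
    by unfold_locales
  have "(\<lambda>k. \<Sum>i\<in>UNIV. (norm (A i *v ((x k - x (Suc k)) $ i)))\<^sup>2)
    \<longlonglongrightarrow> (\<Sum>i\<in>UNIV. (norm (A i *v (0 $ i)))\<^sup>2)"
    by (intro tendsto_intros tendsto_matrix_vector descent_tendsto_0(1))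
  then have block_differences: "(\<lambda>k. \<Sum>i\<in>UNIV. (norm (A i *v (x k $ i - x (Suc k) $ i)))\<^sup>2) \<longlonglongrightarrow> 0"
    by simp
  have "(\<lambda>k. (norm (res (Suc k)))\<^sup>2) \<longlonglongrightarrow> (norm (0 :: real^'n))\<^sup>2"
    by (intro tendsto_intros LIMSEQ_Suc descent_tendsto_0(2))
  then have residuals: "(\<lambda>k. (norm (residual A B b (x (Suc k)) (y (Suc k))))\<^sup>2) \<longlonglongrightarrow> 0"
    by (simp add: res_def)
  have accumulation: "w \<in> W_star I A B b f g Y"
    if "strict_mono s" "(\<lambda>n. (x (s n), y (s n), l (s n))) \<longlonglongrightarrow> w" for s w
    using subsequence_limit_in_W_star[OF that(1)] that(2) by (cases w) auto
  obtain s w where s: "strict_mono s" and w: "(\<lambda>n. (x (s n), y (s n), l (s n))) \<longlonglongrightarrow> w"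
    by (rule convergent_subsequence)
  obtain xa ya la where wa: "w = (xa, ya, la)" by (cases w) auto
  have w_in: "w \<in> W_star I A B b f g Y" by (rule accumulation[OF s w])
  \<comment> \<open>The limit point is itself a solution, so the whole descent argument applies
    again with it as centre.\<close>
  interpret limit: admm_lqp_saddle I A B b f g Y \<beta> \<mu> \<alpha> \<tau> \<gamma> r x y l xa ya la
    using w_in unfolding wa by unfold_locales
  have "(\<lambda>k. (x k, y k, l k)) \<longlonglongrightarrow> w"
    using limit.tendsto_saddle[OF s] w unfolding wa by blast
  with block_differences residuals accumulation w_in show ?thesis
    unfolding accumulation_point_def o_def by blast
qed

end
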